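(* Let $2<p<\infty$. There exist an infinite set $I\subseteq\{3,4,5,\ldots\}$ and, for each $n\in I$, a subset $\mathcal{M}_n\subseteq \ell_p$ with exactly $n$ points, such that the following holds: for every $D\ge 1$ there is a constant $c=c(p,D)>0$ such that for every $n\in I$ and every $m\in\mathbb{N}$, if $\mathcal{M}_n$ (with the metric inherited from $\ell_p$) embeds with distortion $D$ into $\ell_p^m$, then $$m\ge c\left(\frac{\log n}{(\log\log n)^2}\right)^{\frac{p}{2}}.$$
   Context: A metric space $(\mathcal{M},d_{\mathcal{M}})$ embeds with distortion $D\ge 1$ into a metric space $(\mathcal{N},d_{\mathcal{N}})$ if there are $f:\mathcal{M}\to\mathcal{N}$ and $s>0$ such that $s\,d_{\mathcal{M}}(x,y)\le d_{\mathcal{N}}(f(x),f(y))\le Ds\,d_{\mathcal{M}}(x,y)$ for all $x,y\in\mathcal{M}$. $\ell_p$ is the usual Banach space of $p$-summable real sequences with norm $\|x\|_p=(\sum_i|x_i|^p)^{1/p}$, and $\ell_p^m$ is $\mathbb{R}^m$ with the norm $\|x\|_p=(|x_1|^p+\cdots+|x_m|^p)^{1/p}$. $\log$ is the natural logarithm. *)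

theory Defs
  imports "HOL-Analysis.Analysis"
begin

text \<open>
  Metric spaces are given by a carrier set together with a distance function, so that a
  subset of a metric space inherits the metric simply by keeping the distance function.
\<close>

definition embeds_with_distortion ::
  "real \<Rightarrow> 'a set \<Rightarrow> ('a \<Rightarrow> 'a \<Rightarrow> real) \<Rightarrow> 'b set \<Rightarrow> ('b \<Rightarrow> 'b \<Rightarrow> real) \<Rightarrow> bool"
  where "embeds_with_distortion D M dM N dN \<longleftrightarrow>
    (\<exists>f \<in> M \<rightarrow> N. \<exists>s>0. \<forall>x\<in>M. \<forall>y\<in>M.
      s * dM x y \<le> dN (f x) (f y) \<and> dN (f x) (f y) \<le> D * s * dM x y)"

definition lp_space :: "real \<Rightarrow> (nat \<Rightarrow> real) set"
  where "lp_space p = {x. summable (\<lambda>i. \<bar>x i\<bar> powr p)}"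

definition lp_norm :: "real \<Rightarrow> (nat \<Rightarrow> real) \<Rightarrow> real"
  where "lp_norm p x = (\<Sum>i. \<bar>x i\<bar> powr p) powr (1 / p)"

definition lp_dist :: "real \<Rightarrow> (nat \<Rightarrow> real) \<Rightarrow> (nat \<Rightarrow> real) \<Rightarrow> real"
  where "lp_dist p x y = lp_norm p (\<lambda>i. x i - y i)"

text \<open>
  The dimension \<open>m\<close> is quantified inside the statements, so \<open>\<real>\<^sup>m\<close> is represented by the
  functions on \<open>{..<m}\<close> (extended by \<open>undefined\<close>); only the coordinates below \<open>m\<close>
  enter the norm.
\<close>

definition lp_fin_space :: "nat \<Rightarrow> (nat \<Rightarrow> real) set"
  where "lp_fin_space m = ({..<m} \<rightarrow>\<^sub>E UNIV)"

definition lp_fin_norm :: "real \<Rightarrow> nat \<Rightarrow> (nat \<Rightarrow> real) \<Rightarrow> real"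
  where "lp_fin_norm p m x = (\<Sum>i<m. \<bar>x i\<bar> powr p) powr (1 / p)"

definition lp_fin_dist :: "real \<Rightarrow> nat \<Rightarrow> (nat \<Rightarrow> real) \<Rightarrow> (nat \<Rightarrow> real) \<Rightarrow> real"
  where "lp_fin_dist p m x y = lp_fin_norm p m (\<lambda>i. x i - y i)"

end

theory Submission
  imports Defs "HOL-Library.Function_Algebras"
begin

text \<open>
  The set with \<open>n\<close> points is an integer box \<open>{-T..T}\<^sup>k\<close> with its Euclidean metric, where \<open>T\<close> is a
  fixed multiple of \<open>k\<^sup>7\<close>, placed into the sequence space by a linear map of bounded distortion
  (\<open>lattice_into_lp\<close>): by Khintchine's inequality the vector of all signed sums of the coordinates
  of \<open>x\<close> has normalized \<open>p\<close>-norm comparable to the Euclidean norm of \<open>x\<close>. Since \<open>ln n\<close> is of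
  order \<open>k * ln k\<close>, it suffices to show that an embedding of the box with bounded distortion needs
  dimension at least a multiple of \<open>k powr (p / 2)\<close> (\<open>lattice_box_dimension_bound\<close>).

  For a linear map on Euclidean space this is a computation with a Gaussian vector \<open>G\<close>. Each
  coordinate of the image is a linear functional of bounded norm, so its \<open>p\<close>-th moment is bounded
  independently of \<open>k\<close>, whereas the \<open>p\<close>-th moment of the norm of \<open>G\<close> is of order \<open>k powr (p / 2)\<close>.
  For a nonlinear map one replaces linearity by concentration of measure: a Lipschitz
  real function of a Gaussian vector fluctuates by a constant only. The McShane extension makes
  each coordinate of the embedding a Lipschitz function on the whole lattice.

  The Gaussian measure is replaced by the endpoint of a simple random walk of length \<open>T\<close>, which has
  spread \<open>sqrt T\<close>; the claim is that a \<open>1\<close>-Lipschitz function fluctuates by \<open>sqrt (T / k)\<close> only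
  (\<open>walk_concentration\<close>). This needs gradients of bounded Euclidean length, which lattice Lipschitz
  functions do not have at small scales. Averaging over a cube of side \<open>24 * k\<^sup>2\<close> makes the partial
  differences vary slowly (\<open>exists_smoothing\<close>), so that over distances of
  order \<open>k\<close> the function is affine up to an error of at most \<open>k\<close>, and its gradient is bounded (\<open>gradient_bound\<close>). Averages preserve these properties,
  so that the exponential moments of the function can be followed step by step along the walk
  (\<open>walk_iterate_exp\<close>). All losses are polynomial in \<open>k\<close>, and so are absorbed by the choice of \<open>T\<close>.
\<close>

section \<open>Elementary inequalities\<close>

text \<open>
  Bernoulli's inequality for real exponents. It also covers \<open>u = 0\<close>, where it is needed below:
  a distance or a signed sum may vanish.
\<close>
lemma powr_tangent_bound:
  fixes u q :: real
  assumes "u \<ge> 0" "q > 1"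
  shows "1 + q * (u - 1) \<le> u powr q"
proof -
  define q' where "q' = q / (q - 1)"
  have "u * 1 \<le> u powr q / q + 1 powr q' / q'"
    by (rule Youngs_inequality) (use assms in \<open>auto simp: q'_def divide_simps\<close>)
  also have "1 powr q' / q' = 1 - 1 / q"
    using assms by (simp add: q'_def field_simps)
  finally have "q * u \<le> q * (u powr q / q + (1 - 1 / q))"
    using assms by (intro mult_left_mono) auto
  then show ?thesis
    using assms by (simp add: algebra_simps)
qed

text \<open>
  Integrate the tangent line of \<open>u powr q\<close> at the mean \<open>a\<close>: its linear part has weighted sum
  zero.
\<close>
lemma powr_Jensen:
  fixes w u :: "'a \<Rightarrow> real"
  assumes "q > 1" "\<And>x. x \<in> X \<Longrightarrow> w x \<ge> 0" "sum w X = 1" "\<And>x. x \<in> X \<Longrightarrow> u x \<ge> 0"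
  shows "(\<Sum>x\<in>X. w x * u x) powr q \<le> (\<Sum>x\<in>X. w x * u x powr q)"
proof (cases "(\<Sum>x\<in>X. w x * u x) = 0")
  case True
  then show ?thesis
    using assms by (simp add: sum_nonneg)
next
  case False
  define a where "a = (\<Sum>x\<in>X. w x * u x)"
  have a: "a > 0"
    using False assms(2,4) sum_nonneg[of X "\<lambda>x. w x * u x"] unfolding a_def
    by (smt (verit) mult_nonneg_nonneg)
  have "a powr q = a powr q * (\<Sum>x\<in>X. w x * (1 + q * (u x / a - 1)))"
  proof -
    have "(\<Sum>x\<in>X. w x * (1 + q * (u x / a - 1))) = (\<Sum>x\<in>X. (1 - q) * w x + (q / a) * (w x * u x))"
      by (intro sum.cong) (auto simp: algebra_simps)
    also have "\<dots> = (1 - q) * sum w X + (q / a) * a"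
      by (simp add: sum.distrib sum_distrib_left a_def)
    finally show ?thesis using a assms(3) by simp
  qed
  also have "\<dots> \<le> a powr q * (\<Sum>x\<in>X. w x * (u x / a) powr q)"
    using assms(1,2,4) a
    by (intro mult_left_mono sum_mono powr_tangent_bound) auto
  also have "\<dots> = (\<Sum>x\<in>X. w x * u x powr q)"
    using a assms(4) by (simp add: sum_distrib_left powr_divide)
  finally show ?thesis by (simp add: a_def)
qed

lemma abs_add_powr_le:
  fixes a b p :: real
  assumes "p > 0"
  shows "\<bar>a + b\<bar> powr p \<le> 2 powr p * (\<bar>a\<bar> powr p + \<bar>b\<bar> powr p)"
proof -
  have "\<bar>a + b\<bar> powr p \<le> (2 * max \<bar>a\<bar> \<bar>b\<bar>) powr p"
    by (rule powr_mono2) (use assms in auto)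
  also have "\<dots> = 2 powr p * (max \<bar>a\<bar> \<bar>b\<bar>) powr p"
    by (simp add: powr_mult)
  also have "\<dots> \<le> 2 powr p * (\<bar>a\<bar> powr p + \<bar>b\<bar> powr p)"
    by (intro mult_left_mono) (auto simp: max_def)
  finally show ?thesis .
qed

text \<open>
  Turns exponential moments, which behave well under independent sums, into the \<open>p\<close>-th moments
  that occur in the norm.
\<close>
lemma abs_powr_le_exp:
  fixes t p :: real
  assumes "p > 0"
  shows "\<bar>t\<bar> powr p \<le> p powr p * (exp t + exp (- t))"
proof -
  have "\<bar>t\<bar> / p \<le> exp (\<bar>t\<bar> / p)"
    using exp_ge_add_one_self[of "\<bar>t\<bar> / p"] by linarith
  then have "(\<bar>t\<bar> / p) powr p \<le> exp (\<bar>t\<bar> / p) powr p"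
    using assms by (intro powr_mono2) auto
  also have "\<dots> = exp \<bar>t\<bar>"
    using assms by (simp add: powr_def)
  also have "\<dots> \<le> exp t + exp (- t)"
    by (cases "t \<ge> 0") auto
  finally show ?thesis
    using assms by (simp add: powr_divide field_simps)
qed

lemma exp_le_quadratic:
  fixes y :: real
  assumes "\<bar>y\<bar> \<le> 1"
  shows "exp y \<le> 1 + y + y\<^sup>2"
proof (cases "y \<ge> 0")
  case True
  then show ?thesis using exp_bound assms by auto
next
  case False
  have "(1 + y + y\<^sup>2) * (1 - y) = 1 - y ^ 3"
    by (simp add: power2_eq_square power3_eq_cube algebra_simps)
  moreover have "y ^ 3 \<le> 0"
    using False by (simp add: power3_eq_cube mult_nonneg_nonpos)
  ultimately have "1 \<le> (1 + y + y\<^sup>2) * (1 - y)"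
    by linarith
  also have "\<dots> \<le> (1 + y + y\<^sup>2) * exp (- y)"
  proof (intro mult_left_mono)
    show "1 - y \<le> exp (- y)" using exp_ge_add_one_self[of "- y"] by simp
    show "0 \<le> 1 + y + y\<^sup>2" using assms by (auto simp: abs_if split: if_splits)
  qed
  finally show ?thesis by (simp add: exp_minus field_simps)
qed

section \<open>Lipschitz functions on the integer lattice\<close>

text \<open>
  Lattice points are total functions, so that they can be added; the distance only sees the first
  \<open>k\<close> coordinates.
\<close>
definition edist :: "nat \<Rightarrow> (nat \<Rightarrow> int) \<Rightarrow> (nat \<Rightarrow> int) \<Rightarrow> real"
  where "edist k x y = L2_set (\<lambda>j. real_of_int (x j - y j)) {..<k}"

definition on_axis :: "nat \<Rightarrow> int \<Rightarrow> nat \<Rightarrow> int"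
  where "on_axis j t = (\<lambda>i. if i = j then t else 0)"

lemma edist_nonneg [simp]: "edist k x y \<ge> 0"
  by (simp add: edist_def)

lemma edist_commute: "edist k x y = edist k y x"
  by (simp add: edist_def L2_set_def power2_commute)

lemma edist_triangle: "edist k x z \<le> edist k x y + edist k y z"
  using L2_set_triangle_ineq[of "\<lambda>j. real_of_int (x j - y j)" "\<lambda>j. real_of_int (y j - z j)" "{..<k}"]
  by (simp add: edist_def)

lemma edist_translate [simp]: "edist k (x + w) (y + w) = edist k x y"
  by (simp add: edist_def)

lemma edist_self [simp]: "edist k x x = 0"
  by (simp add: edist_def L2_set_def)

lemma edist_power2: "(edist k x y)\<^sup>2 = (\<Sum>j<k. (real_of_int (x j - y j))\<^sup>2)"
  by (simp add: edist_def L2_set_def sum_nonneg)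

lemma edist_add_on_axis: "edist k (x + on_axis j t) x \<le> \<bar>real_of_int t\<bar>"
proof -
  have "edist k (x + on_axis j t) x \<le> (\<Sum>i<k. \<bar>real_of_int (on_axis j t i)\<bar>)"
    using L2_set_le_sum_abs[of "\<lambda>i. real_of_int (on_axis j t i)" "{..<k}"] by (simp add: edist_def)
  also have "\<dots> = (\<Sum>i<k. if i = j then \<bar>real_of_int t\<bar> else 0)"
    by (intro sum.cong) (auto simp: on_axis_def)
  also have "\<dots> \<le> \<bar>real_of_int t\<bar>" by simp
  finally show ?thesis .
qed

text \<open>
  The constant \<open>C\<close> is kept as a parameter because the notion is applied both to functions (with
  \<open>C = 1\<close>) and to their partial differences (with a small \<open>C\<close>, which is a second-order bound).
\<close>
definition lattice_lipschitz :: "nat \<Rightarrow> real \<Rightarrow> ((nat \<Rightarrow> int) \<Rightarrow> real) \<Rightarrow> bool"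
  where "lattice_lipschitz k C \<phi> \<longleftrightarrow> (\<forall>x y. \<bar>\<phi> x - \<phi> y\<bar> \<le> C * edist k x y)"

definition pdiff :: "nat \<Rightarrow> ((nat \<Rightarrow> int) \<Rightarrow> real) \<Rightarrow> (nat \<Rightarrow> int) \<Rightarrow> real"
  where "pdiff j \<phi> x = \<phi> (x + on_axis j 1) - \<phi> x"

lemma lattice_lipschitzD: "lattice_lipschitz k C \<phi> \<Longrightarrow> \<bar>\<phi> x - \<phi> y\<bar> \<le> C * edist k x y"
  by (simp add: lattice_lipschitz_def)

text \<open>
  Both the smoothing and the random walk average over finitely many translates. Such averages
  commute with differences and with translations of the lattice, so they preserve every Lipschitz
  bound.
\<close>
definition shift_avg ::
  "'a set \<Rightarrow> ('a \<Rightarrow> nat \<Rightarrow> int) \<Rightarrow> ((nat \<Rightarrow> int) \<Rightarrow> real) \<Rightarrow> (nat \<Rightarrow> int) \<Rightarrow> real"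
  where "shift_avg W s \<phi> x = (\<Sum>a\<in>W. \<phi> (x + s a)) / real (card W)"

lemma shift_avg_dist_le:
  assumes "finite W" "W \<noteq> {}" "\<And>a. a \<in> W \<Longrightarrow> \<bar>\<phi> (x + s a) - c\<bar> \<le> e"
  shows "\<bar>shift_avg W s \<phi> x - c\<bar> \<le> e"
proof -
  have n: "real (card W) > 0" using assms(1,2) by (simp add: card_gt_0_iff)
  have "shift_avg W s \<phi> x - c = (\<Sum>a\<in>W. \<phi> (x + s a) - c) / real (card W)"
    using n by (simp add: shift_avg_def sum_subtractf field_simps)
  also have "\<bar>\<dots>\<bar> = \<bar>\<Sum>a\<in>W. \<phi> (x + s a) - c\<bar> / real (card W)" by simp
  also have "\<dots> \<le> (\<Sum>a\<in>W. e) / real (card W)"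
    by (intro divide_right_mono order.trans[OF sum_abs] sum_mono assms) auto
  also have "\<dots> = e" using n by simp
  finally show ?thesis .
qed

lemma lattice_lipschitz_shift_avg:
  assumes "finite W" "W \<noteq> {}" "lattice_lipschitz k C \<phi>"
  shows "lattice_lipschitz k C (shift_avg W s \<phi>)"
  unfolding lattice_lipschitz_def
proof (intro allI)
  fix x y
  have "shift_avg W s \<phi> x - shift_avg W s \<phi> y
      = shift_avg W s (\<lambda>z. \<phi> z - \<phi> (z + (y - x))) x"
    by (simp add: shift_avg_def sum_subtractf diff_divide_distrib algebra_simps)
  moreover have "\<bar>shift_avg W s (\<lambda>z. \<phi> z - \<phi> (z + (y - x))) x - 0\<bar> \<le> C * edist k x y"
  proof (rule shift_avg_dist_le[OF assms(1,2)])
    fix a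
    have "edist k (x + s a) (x + s a + (y - x)) = edist k (x + s a) (y + s a)"
      by (simp add: algebra_simps)
    then show "\<bar>\<phi> (x + s a) - \<phi> (x + s a + (y - x)) - 0\<bar> \<le> C * edist k x y"
      using lattice_lipschitzD[OF assms(3), of "x + s a" "x + s a + (y - x)"] by simp
  qed
  ultimately show "\<bar>shift_avg W s \<phi> x - shift_avg W s \<phi> y\<bar> \<le> C * edist k x y" by simp
qed

lemma pdiff_shift_avg: "pdiff j (shift_avg W s \<phi>) = shift_avg W s (pdiff j \<phi>)"
  by (rule ext) (simp add: pdiff_def shift_avg_def sum_subtractf diff_divide_distrib add_ac)

section \<open>Smoothing by box averages\<close>

definition seg_avg :: "nat \<Rightarrow> nat \<Rightarrow> ((nat \<Rightarrow> int) \<Rightarrow> real) \<Rightarrow> (nat \<Rightarrow> int) \<Rightarrow> real"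
  where "seg_avg b j = shift_avg {..<b} (\<lambda>t. on_axis j (int t))"

lemma on_axis_add: "on_axis j s + on_axis j t = on_axis j (s + t)"
  by (auto simp: on_axis_def)

lemma on_axis_0 [simp]: "on_axis j 0 = 0"
  by (auto simp: on_axis_def)

text \<open>
  Averaging over a segment of length \<open>b\<close> in direction \<open>j\<close> makes the difference in that direction
  telescope to a difference quotient at scale \<open>b\<close>. The Lipschitz bound for \<open>\<phi>\<close> itself, divided by
  \<open>b\<close>, is then a Lipschitz bound for the difference.
\<close>
lemma lattice_lipschitz_pdiff_seg_avg:
  assumes "b > 0" "lattice_lipschitz k 1 \<phi>"
  shows "lattice_lipschitz k (2 / real b) (pdiff j (seg_avg b j \<phi>))"
  unfolding lattice_lipschitz_def
proof (intro allI)
  fix x y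
  have tele: "pdiff j (seg_avg b j \<phi>) z = (\<phi> (z + on_axis j (int b)) - \<phi> z) / real b" for z
  proof -
    have "pdiff j (seg_avg b j \<phi>) z
        = (\<Sum>t<b. \<phi> (z + on_axis j (int (Suc t))) - \<phi> (z + on_axis j (int t))) / real b"
      by (simp add: seg_avg_def pdiff_shift_avg shift_avg_def)
        (simp add: pdiff_def add.assoc on_axis_add add.commute[of _ 1])
    also have "(\<Sum>t<b. \<phi> (z + on_axis j (int (Suc t))) - \<phi> (z + on_axis j (int t)))
        = \<phi> (z + on_axis j (int b)) - \<phi> z"
      by (subst sum_lessThan_telescope) simp
    finally show ?thesis .
  qed
  have "\<bar>\<phi> (x + on_axis j (int b)) - \<phi> (y + on_axis j (int b))\<bar> \<le> edist k x y" "\<bar>\<phi> x - \<phi> y\<bar> \<le> edist k x y"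
    using lattice_lipschitzD[OF assms(2)] edist_translate by (metis mult_1)+
  then have "\<bar>(\<phi> (x + on_axis j (int b)) - \<phi> x) - (\<phi> (y + on_axis j (int b)) - \<phi> y)\<bar> \<le> 2 * edist k x y"
    by linarith
  then show "\<bar>pdiff j (seg_avg b j \<phi>) x - pdiff j (seg_avg b j \<phi>) y\<bar> \<le> 2 / real b * edist k x y"
    unfolding tele diff_divide_distrib[symmetric] abs_divide
    by (simp add: divide_right_mono)
qed

lemma seg_avg_close:
  assumes "b > 0" "lattice_lipschitz k 1 \<phi>"
  shows "\<bar>seg_avg b j \<phi> x - \<phi> x\<bar> \<le> real b"
  unfolding seg_avg_def
proof (rule shift_avg_dist_le)
  fix t assume "t \<in> {..<b}"
  then show "\<bar>\<phi> (x + on_axis j (int t)) - \<phi> x\<bar> \<le> real b"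
    using lattice_lipschitzD[OF assms(2), of "x + on_axis j (int t)" x] edist_add_on_axis[of k x j "int t"]
    by (simp del: of_nat_less_iff add: of_nat_less_iff[symmetric, where 'a=real])
qed (use assms in \<open>auto simp: lessThan_empty_iff\<close>)

text \<open>
  Average in one direction after the other; an average in a new direction preserves the bounds
  already gained.
\<close>
lemma exists_smoothing:
  assumes b: "b > 0" and F: "lattice_lipschitz k 1 F"
  shows "\<exists>g. lattice_lipschitz k 1 g \<and> (\<forall>j<n. lattice_lipschitz k (2 / real b) (pdiff j g))
    \<and> (\<forall>x. \<bar>g x - F x\<bar> \<le> real n * real b)"
proof (induction n)
  case 0
  show ?case using F by auto
next
  case (Suc n)
  then obtain g where g: "lattice_lipschitz k 1 g" "\<forall>j<n. lattice_lipschitz k (2 / real b) (pdiff j g)"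
    "\<forall>x. \<bar>g x - F x\<bar> \<le> real n * real b" by blast
  have ne: "{..<b} \<noteq> {}" using b by (auto simp: lessThan_empty_iff)
  show ?case
  proof (intro exI[of _ "seg_avg b n g"] conjI allI impI)
    show "lattice_lipschitz k 1 (seg_avg b n g)"
      unfolding seg_avg_def by (intro lattice_lipschitz_shift_avg g ne) auto
    fix j assume "j < Suc n"
    show "lattice_lipschitz k (2 / real b) (pdiff j (seg_avg b n g))"
    proof (cases "j = n")
      case True
      then show ?thesis using lattice_lipschitz_pdiff_seg_avg[OF b g(1)] by simp
    next
      case False
      then show ?thesis using g(2) \<open>j < Suc n\<close> ne
        by (simp add: seg_avg_def pdiff_shift_avg lattice_lipschitz_shift_avg)
    qed
  next
    fix x
    show "\<bar>seg_avg b n g x - F x\<bar> \<le> real (Suc n) * real b"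
      using seg_avg_close[OF b g(1), of n x] g(3)[rule_format, of x]
      by (simp add: algebra_simps)
  qed
qed

section \<open>The gradient of a smooth Lipschitz function\<close>

lemma axis_taylor_nat:
  assumes "lattice_lipschitz k \<delta> (pdiff j g)" "\<delta> \<ge> 0"
  shows "\<bar>g (x + on_axis j (int t)) - g x - real t * pdiff j g x\<bar> \<le> \<delta> * (real t)\<^sup>2"
proof (induction t)
  case 0
  show ?case by simp
next
  case (Suc t)
  let ?y = "x + on_axis j (int t)"
  have "g (x + on_axis j (int (Suc t))) = g ?y + pdiff j g ?y"
    by (simp add: pdiff_def add.assoc on_axis_add add.commute[of 1])
  moreover have "\<bar>pdiff j g ?y - pdiff j g x\<bar> \<le> \<delta> * real t"
    using lattice_lipschitzD[OF assms(1), of ?y x] edist_add_on_axis[of k x j "int t"]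
      mult_left_mono[OF _ assms(2)] by fastforce
  ultimately have "\<bar>g (x + on_axis j (int (Suc t))) - g x - real (Suc t) * pdiff j g x\<bar>
      \<le> \<delta> * (real t)\<^sup>2 + \<delta> * real t"
    using Suc unfolding of_nat_Suc distrib_right by linarith
  also have "\<dots> \<le> \<delta> * (real (Suc t))\<^sup>2"
    using assms(2) by (simp add: power2_eq_square algebra_simps)
  finally show ?case .
qed

text \<open>
  For negative \<open>t\<close>, expand at the endpoint and move the difference back to \<open>x\<close>; this costs the
  factor \<open>2\<close>.
\<close>
lemma axis_taylor:
  assumes "lattice_lipschitz k \<delta> (pdiff j g)" "\<delta> \<ge> 0"
  shows "\<bar>g (x + on_axis j t) - g x - real_of_int t * pdiff j g x\<bar> \<le> 2 * \<delta> * (real_of_int t)\<^sup>2"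
proof (cases "t \<ge> 0")
  case True
  have "\<delta> * (real_of_int t)\<^sup>2 \<ge> 0" using assms(2) by simp
  then show ?thesis
    using axis_taylor_nat[OF assms, of x "nat t"] True by simp
next
  case False
  define n where "n = nat (- t)"
  define y where "y = x + on_axis j t"
  have n: "real n = - real_of_int t" "t = - int n" using False by (auto simp: n_def)
  have x: "x = y + on_axis j (int n)"
    by (simp add: y_def n(2) add.assoc on_axis_add)
  have "\<bar>g x - g y - real n * pdiff j g y\<bar> \<le> \<delta> * (real n)\<^sup>2"
    using axis_taylor_nat[OF assms, of y n] x by simp
  moreover have "\<bar>real n * pdiff j g x - real n * pdiff j g y\<bar> \<le> \<delta> * (real n)\<^sup>2"
  proof -
    have "\<bar>pdiff j g x - pdiff j g y\<bar> \<le> \<delta> * real n"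
      using lattice_lipschitzD[OF assms(1), of x y] edist_add_on_axis[of k y j "int n"] x
        mult_left_mono[OF _ assms(2)] by fastforce
    then have "real n * \<bar>pdiff j g x - pdiff j g y\<bar> \<le> real n * (\<delta> * real n)"
      by (intro mult_left_mono) auto
    then show ?thesis
      unfolding right_diff_distrib[symmetric] abs_mult by (simp add: power2_eq_square mult_ac)
  qed
  ultimately have "\<bar>g y - g x + real n * pdiff j g x\<bar> \<le> 2 * \<delta> * (real n)\<^sup>2"
    by linarith
  then show ?thesis using n(1) by (simp add: y_def)
qed

text \<open>
  Move from \<open>x\<close> to \<open>x + v\<close> one coordinate at a time. Each leg is a one-dimensional Taylor step,
  and the difference quotient on it is close to the one at \<open>x\<close> since all intermediate points
  stay within distance \<open>V\<close> of \<open>x\<close>.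
\<close>
lemma lattice_taylor:
  fixes v :: "nat \<Rightarrow> int"
  assumes glip: "\<And>j. j < k \<Longrightarrow> lattice_lipschitz k \<delta> (pdiff j g)" and "\<delta> \<ge> 0"
    and V: "V \<ge> 0" "(\<Sum>j<k. (real_of_int (v j))\<^sup>2) \<le> V\<^sup>2" and "n \<le> k"
  shows "\<bar>g (x + (\<lambda>j. if j < n then v j else 0)) - g x - (\<Sum>j<n. real_of_int (v j) * pdiff j g x)\<bar>
      \<le> real n * (3 * \<delta> * V\<^sup>2)"
  using \<open>n \<le> k\<close>
proof (induction n)
  case 0
  have "x + (\<lambda>j. 0) = x" by auto
  then show ?case by simp
next
  case (Suc n)
  let ?y = "x + (\<lambda>j. if j < n then v j else 0)"
  have n: "n < k" using Suc.prems by simp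
  have step: "x + (\<lambda>j. if j < Suc n then v j else 0) = ?y + on_axis n (v n)"
    by (auto simp: on_axis_def fun_eq_iff)
  have "(real_of_int (v n))\<^sup>2 \<le> (\<Sum>j<k. (real_of_int (v j))\<^sup>2)"
    by (rule member_le_sum[of n "{..<k}"]) (use n in auto)
  then have vn2: "(real_of_int (v n))\<^sup>2 \<le> V\<^sup>2" using V by linarith
  then have vn: "\<bar>real_of_int (v n)\<bar> \<le> V" using V(1) abs_le_square_iff[of "real_of_int (v n)" V] by simp
  have "(edist k ?y x)\<^sup>2 \<le> (\<Sum>j<k. (real_of_int (v j))\<^sup>2)"
    unfolding edist_power2 by (intro sum_mono) auto
  then have ed: "edist k ?y x \<le> V"
    using V power2_le_imp_le by (meson order.trans)
  have "\<bar>pdiff n g ?y - pdiff n g x\<bar> \<le> \<delta> * edist k ?y x"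
    by (rule lattice_lipschitzD[OF glip[OF n]])
  also have "\<dots> \<le> \<delta> * V" using ed assms(2) by (intro mult_left_mono)
  finally have "\<bar>real_of_int (v n)\<bar> * \<bar>pdiff n g ?y - pdiff n g x\<bar> \<le> V * (\<delta> * V)"
    using vn V(1) by (intro mult_mono) auto
  then have 1: "\<bar>real_of_int (v n) * pdiff n g ?y - real_of_int (v n) * pdiff n g x\<bar> \<le> \<delta> * V\<^sup>2"
    unfolding right_diff_distrib[symmetric] abs_mult by (simp add: power2_eq_square mult_ac)
  have "\<delta> * (real_of_int (v n))\<^sup>2 \<le> \<delta> * V\<^sup>2"
    using vn2 assms(2) by (rule mult_left_mono)
  then have 2: "\<bar>g (?y + on_axis n (v n)) - g ?y - real_of_int (v n) * pdiff n g ?y\<bar> \<le> 2 * \<delta> * V\<^sup>2"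
    using axis_taylor[OF glip[OF n] assms(2), of ?y "v n"] by linarith
  have 3: "\<bar>g ?y - g x - (\<Sum>j<n. real_of_int (v j) * pdiff j g x)\<bar> \<le> real n * (3 * \<delta> * V\<^sup>2)"
    using Suc.IH n by linarith
  have "real (Suc n) * (3 * \<delta> * V\<^sup>2) = real n * (3 * \<delta> * V\<^sup>2) + 2 * \<delta> * V\<^sup>2 + \<delta> * V\<^sup>2"
    by (simp add: algebra_simps)
  then show ?case
    unfolding step sum.lessThan_Suc using 1 2 3 by linarith
qed

text \<open>
  A smooth \<open>1\<close>-Lipschitz function has gradient of bounded Euclidean length. A lattice Lipschitz
  function without the smoothness assumption may change by \<open>1\<close> in each of the \<open>k\<close> directions,
  with gradient of length \<open>sqrt k\<close>. To exploit smoothness, move a distance of about \<open>2 * k\<close> in the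
  direction of the gradient \<open>a\<close>, rounded towards zero to a lattice vector \<open>v\<close>: rounding loses at
  most \<open>k * A\<close> of the gain \<open>2 * k * A\<close>, where \<open>A\<close> is the length of \<open>a\<close>, the Taylor error is at
  most \<open>k\<close>, and the function changes by at most \<open>2 * k\<close>.
\<close>
lemma gradient_bound:
  assumes lip: "lattice_lipschitz k 1 g"
    and glip: "\<And>j. j < k \<Longrightarrow> lattice_lipschitz k \<delta> (pdiff j g)"
    and d: "\<delta> \<ge> 0" "12 * (real k)\<^sup>2 * \<delta> \<le> 1" and k: "k > 0"
  shows "(\<Sum>j<k. (pdiff j g x)\<^sup>2) \<le> 9"
proof -
  define a where "a = (\<lambda>j. pdiff j g x)"
  define A where "A = L2_set a {..<k}"
  have A2: "(\<Sum>j<k. (a j)\<^sup>2) = A\<^sup>2" by (simp add: A_def L2_set_def sum_nonneg)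
  have "A \<le> 3"
  proof (cases "A = 0")
    case False
    then have A: "A > 0" by (simp add: A_def less_le)
    define t where "t = (\<lambda>j. 2 * real k * \<bar>a j\<bar> / A)"
    define v :: "nat \<Rightarrow> int" where "v = (\<lambda>j. if a j \<ge> 0 then \<lfloor>t j\<rfloor> else - \<lfloor>t j\<rfloor>)"
    have t0: "t j \<ge> 0" for j using A by (simp add: t_def)
    have "(real_of_int (v j))\<^sup>2 \<le> (t j)\<^sup>2" for j
      using t0[of j] by (auto simp: v_def intro!: power_mono)
    then have "(\<Sum>j<k. (real_of_int (v j))\<^sup>2) \<le> (\<Sum>j<k. (t j)\<^sup>2)" by (intro sum_mono)
    also have "\<dots> = (2 * real k / A)\<^sup>2 * (\<Sum>j<k. (a j)\<^sup>2)"
      by (simp add: t_def power_divide power_mult_distrib sum_distrib_left sum_divide_distrib)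
    also have "\<dots> = (2 * real k)\<^sup>2" using A by (simp add: A2 power_divide)
    finally have v2: "(\<Sum>j<k. (real_of_int (v j))\<^sup>2) \<le> (2 * real k)\<^sup>2" .
    let ?y = "x + (\<lambda>j. if j < k then v j else 0)"
    have "(edist k ?y x)\<^sup>2 = (\<Sum>j<k. (real_of_int (v j))\<^sup>2)"
      unfolding edist_power2 by (intro sum.cong) auto
    then have "edist k ?y x \<le> 2 * real k"
      using v2 power2_le_imp_le[of "edist k ?y x" "2 * real k"] by simp
    then have "\<bar>g ?y - g x\<bar> \<le> 2 * real k"
      using lattice_lipschitzD[OF lip, of ?y x] by simp
    moreover have "\<bar>g ?y - g x - (\<Sum>j<k. real_of_int (v j) * a j)\<bar> \<le> real k * (3 * \<delta> * (2 * real k)\<^sup>2)"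
      unfolding a_def by (rule lattice_taylor[OF glip d(1) _ v2]) auto
    moreover have "real k * (3 * \<delta> * (2 * real k)\<^sup>2) \<le> real k * 1"
      using d(2) by (intro mult_left_mono) (auto simp: power2_eq_square algebra_simps)
    ultimately have up: "(\<Sum>j<k. real_of_int (v j) * a j) \<le> 3 * real k"
      by linarith
    have "real k * A = (\<Sum>j<k. (2 * real k / A) * (a j)\<^sup>2 - A)"
      unfolding sum_subtractf sum_distrib_left[symmetric] A2
      using A by (simp add: power2_eq_square)
    also have "\<dots> \<le> (\<Sum>j<k. real_of_int (v j) * a j)"
    proof (intro sum_mono)
      fix j assume j: "j \<in> {..<k}"
      have "\<bar>a j\<bar> \<le> A"
        using member_le_L2_set[of "{..<k}" j "\<lambda>j. \<bar>a j\<bar>"] j by (simp add: A_def L2_set_def)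
      moreover have "real_of_int (v j) * a j = real_of_int \<lfloor>t j\<rfloor> * \<bar>a j\<bar>"
        by (simp add: v_def)
      moreover have "(t j - 1) * \<bar>a j\<bar> \<le> real_of_int \<lfloor>t j\<rfloor> * \<bar>a j\<bar>"
        by (intro mult_right_mono) linarith+
      moreover have "t j * \<bar>a j\<bar> = (2 * real k / A) * (a j)\<^sup>2"
        by (simp add: t_def power2_eq_square)
      ultimately show "(2 * real k / A) * (a j)\<^sup>2 - A \<le> real_of_int (v j) * a j"
        by (simp add: left_diff_distrib)
    qed
    finally have "real k * A \<le> real k * 3" using up by linarith
    then show ?thesis using k by simp
  qed auto
  then have "A\<^sup>2 \<le> 3\<^sup>2" by (intro power_mono) (auto simp: A_def)
  then show ?thesis using A2 by (simp add: a_def)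
qed

section \<open>The simple random walk\<close>

definition walk :: "nat \<Rightarrow> ((nat \<Rightarrow> int) \<Rightarrow> real) \<Rightarrow> (nat \<Rightarrow> int) \<Rightarrow> real"
  where "walk k = shift_avg ({..<k} \<times> {1, - 1}) (\<lambda>(j, t). on_axis j t)"

lemma walk_eq:
  "walk k \<phi> z = (\<Sum>j<k. \<phi> (z + on_axis j 1) + \<phi> (z + on_axis j (- 1))) / (2 * real k)"
proof -
  have "(\<Sum>a\<in>{..<k} \<times> {1, - 1}. \<phi> (z + (case a of (j, t) \<Rightarrow> on_axis j t)))
      = (\<Sum>j<k. \<Sum>t\<in>{1, - 1}. \<phi> (z + on_axis j t))"
    by (simp only: sum.cartesian_product split_def fst_conv snd_conv)
  also have "\<dots> = (\<Sum>j<k. \<phi> (z + on_axis j 1) + \<phi> (z + on_axis j (- 1)))" by simp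
  finally show ?thesis
    by (simp add: walk_def shift_avg_def card_cartesian_product)
qed

lemma walk_mono: "(\<And>x. \<phi> x \<le> \<psi> x) \<Longrightarrow> walk k \<phi> z \<le> walk k \<psi> z"
  unfolding walk_eq by (intro divide_right_mono sum_mono add_mono) auto

lemma walk_mult_left: "walk k (\<lambda>x. c * \<phi> x) z = c * walk k \<phi> z"
  unfolding walk_eq by (simp add: sum_distrib_left flip: distrib_left)

lemma lattice_lipschitz_walk:
  assumes "k > 0" "lattice_lipschitz k C \<phi>"
  shows "lattice_lipschitz k C (walk k \<phi>)"
  unfolding walk_def by (rule lattice_lipschitz_shift_avg) (use assms in \<open>auto simp: lessThan_empty_iff\<close>)

lemma pdiff_walk: "pdiff j (walk k \<phi>) = walk k (pdiff j \<phi>)"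
  by (simp add: walk_def pdiff_shift_avg)

text \<open>
  One step changes \<open>g\<close> by at most \<open>1\<close>, and the mean square of the change is of order \<open>1 / k\<close> by
  the gradient bound, because the walk picks one of \<open>k\<close> directions. Expanding the exponential to
  second order gives a factor \<open>1 + O(l\<^sup>2 / k)\<close> besides the effect of the drift.
\<close>
lemma walk_exp_step:
  assumes lip: "lattice_lipschitz k 1 g"
    and glip: "\<And>j. j < k \<Longrightarrow> lattice_lipschitz k \<delta> (pdiff j g)"
    and d: "\<delta> \<ge> 0" "12 * (real k)\<^sup>2 * \<delta> \<le> 1" and k: "k > 0" and l: "\<bar>l\<bar> \<le> 1"
  shows "walk k (\<lambda>x. exp (l * g x)) z \<le> exp (15 * l\<^sup>2 / real k) * exp (l * walk k g z)"
proof -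
  define y where "y = (\<lambda>j t. g (z + on_axis j t) - g z)"
  have y1: "\<bar>l * y j t\<bar> \<le> 1" if "\<bar>t\<bar> = 1" for j t
  proof -
    have "\<bar>y j t\<bar> \<le> 1"
      using lattice_lipschitzD[OF lip, of "z + on_axis j t" z] edist_add_on_axis[of k z j t] that
      by (simp add: y_def flip: of_int_abs)
    then show ?thesis using l by (simp add: abs_mult mult_le_one)
  qed
  have D: "\<delta> \<le> 1"
  proof -
    have "1 \<le> (real k)\<^sup>2" using k by (intro one_le_power) simp
    then have "1 * \<delta> \<le> 12 * (real k)\<^sup>2 * \<delta>"
      using d(1) by (intro mult_right_mono) linarith+
    then show ?thesis using d(2) by linarith
  qed
  have sq: "(\<Sum>j<k. (y j 1)\<^sup>2 + (y j (- 1))\<^sup>2) \<le> 30"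
  proof -
    have "(y j 1)\<^sup>2 + (y j (- 1))\<^sup>2 \<le> 3 * (pdiff j g z)\<^sup>2 + 2 * \<delta>\<^sup>2" if "j < k" for j
    proof -
      have a: "y j (- 1) = - pdiff j g (z + on_axis j (- 1))"
        by (simp add: y_def pdiff_def add.assoc on_axis_add)
      have "\<bar>pdiff j g (z + on_axis j (- 1)) - pdiff j g z\<bar> \<le> \<delta> * edist k (z + on_axis j (- 1)) z"
        by (rule lattice_lipschitzD[OF glip[OF that]])
      also have "\<dots> \<le> \<delta> * 1"
        using edist_add_on_axis[of k z j "- 1"] d(1) by (intro mult_left_mono) auto
      finally have "\<bar>y j (- 1) + pdiff j g z\<bar> \<le> \<delta>" using a by simp
      then have "(y j (- 1) + pdiff j g z)\<^sup>2 \<le> \<delta>\<^sup>2"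
        using d(1) abs_le_square_iff[of "y j (- 1) + pdiff j g z" \<delta>] by simp
      moreover have "(y j (- 1))\<^sup>2 \<le> 2 * (y j (- 1) + pdiff j g z)\<^sup>2 + 2 * (pdiff j g z)\<^sup>2"
        using zero_le_power2[of "y j (- 1) + 2 * pdiff j g z"]
        by (simp add: power2_eq_square algebra_simps)
      ultimately show ?thesis by (simp add: y_def pdiff_def)
    qed
    then have "(\<Sum>j<k. (y j 1)\<^sup>2 + (y j (- 1))\<^sup>2) \<le> (\<Sum>j<k. 3 * (pdiff j g z)\<^sup>2 + 2 * \<delta>\<^sup>2)"
      by (intro sum_mono) auto
    also have "\<dots> = 3 * (\<Sum>j<k. (pdiff j g z)\<^sup>2) + 2 * (real k * \<delta>\<^sup>2)"
      by (simp add: sum.distrib sum_distrib_left)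
    also have "\<dots> \<le> 3 * 9 + 2 * 1"
    proof -
      have "real k * \<delta> \<le> 12 * (real k)\<^sup>2 * \<delta>"
        using k d(1) by (intro mult_right_mono) (auto simp: power2_eq_square)
      then have "real k * \<delta> \<le> 1" using d(2) by linarith
      then have "real k * \<delta> * \<delta> \<le> 1" using D d(1) by (simp add: mult_le_one)
      then have "real k * \<delta>\<^sup>2 \<le> 1" by (simp add: power2_eq_square mult.assoc)
      then show ?thesis using gradient_bound[OF lip glip d k, of z] by linarith
    qed
    finally show ?thesis by simp
  qed
  have exp_y: "exp (l * g (z + on_axis j t)) = exp (l * g z) * exp (l * y j t)" for j t
    unfolding exp_add[symmetric] by (simp add: y_def right_diff_distrib)
  have "walk k (\<lambda>x. exp (l * g x)) z
      = exp (l * g z) * ((\<Sum>j<k. exp (l * y j 1) + exp (l * y j (- 1))) / (2 * real k))"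
    by (simp add: walk_eq exp_y sum_distrib_left distrib_left)
  also have "\<dots> \<le> exp (l * g z) * ((\<Sum>j<k. (1 + l * y j 1 + (l * y j 1)\<^sup>2)
      + (1 + l * y j (- 1) + (l * y j (- 1))\<^sup>2)) / (2 * real k))"
    by (intro mult_left_mono divide_right_mono sum_mono add_mono exp_le_quadratic y1) auto
  also have "(\<Sum>j<k. (1 + l * y j 1 + (l * y j 1)\<^sup>2) + (1 + l * y j (- 1) + (l * y j (- 1))\<^sup>2))
      = 2 * real k + l * (\<Sum>j<k. y j 1 + y j (- 1)) + l\<^sup>2 * (\<Sum>j<k. (y j 1)\<^sup>2 + (y j (- 1))\<^sup>2)"
    by (simp add: sum.distrib sum_distrib_left power_mult_distrib algebra_simps)
  also have "exp (l * g z) * ((2 * real k + l * (\<Sum>j<k. y j 1 + y j (- 1)) + l\<^sup>2 * (\<Sum>j<k. (y j 1)\<^sup>2 + (y j (- 1))\<^sup>2)) / (2 * real k))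
      \<le> exp (l * g z) * ((2 * real k + l * (\<Sum>j<k. y j 1 + y j (- 1)) + l\<^sup>2 * 30) / (2 * real k))"
    using sq by (intro mult_left_mono divide_right_mono add_left_mono) auto
  also have "(2 * real k + l * (\<Sum>j<k. y j 1 + y j (- 1)) + l\<^sup>2 * 30) / (2 * real k)
      = 1 + (15 * l\<^sup>2 / real k + l * (walk k g z - g z))"
    using k by (simp add: walk_eq y_def sum.distrib sum_subtractf field_simps)
  also have "exp (l * g z) * \<dots> \<le> exp (l * g z) * exp (15 * l\<^sup>2 / real k + l * (walk k g z - g z))"
    by (intro mult_left_mono) auto
  also have "\<dots> = exp (15 * l\<^sup>2 / real k) * exp (l * walk k g z)"
    unfolding exp_add[symmetric] by (simp add: right_diff_distrib)
  finally show ?thesis .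
qed

text \<open>
  The one-step estimate applies again to \<open>walk k g\<close>, which satisfies the same Lipschitz and
  smoothness bounds as \<open>g\<close>. This replaces the usual martingale argument.
\<close>
lemma walk_iterate_exp:
  assumes lip: "lattice_lipschitz k 1 g"
    and glip: "\<And>j. j < k \<Longrightarrow> lattice_lipschitz k \<delta> (pdiff j g)"
    and d: "\<delta> \<ge> 0" "12 * (real k)\<^sup>2 * \<delta> \<le> 1" and k: "k > 0" and l: "\<bar>l\<bar> \<le> 1"
  shows "(walk k ^^ T) (\<lambda>x. exp (l * g x)) z
    \<le> exp (15 * l\<^sup>2 / real k) ^ T * exp (l * (walk k ^^ T) g z)"
proof (induction T arbitrary: z)
  case 0
  show ?case by simp
next
  case (Suc T)
  let ?K = "exp (15 * l\<^sup>2 / real k)" and ?h = "(walk k ^^ T) g"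
  have h: "lattice_lipschitz k 1 ?h \<and> (\<forall>j<k. lattice_lipschitz k \<delta> (pdiff j ?h))"
  proof (induction T)
    case 0
    show ?case using lip glip by simp
  next
    case (Suc T)
    then show ?case using k by (simp add: pdiff_walk lattice_lipschitz_walk)
  qed
  have "(walk k ^^ Suc T) (\<lambda>x. exp (l * g x)) z \<le> walk k (\<lambda>x. ?K ^ T * exp (l * ?h x)) z"
    using walk_mono[OF Suc.IH] by simp
  also have "\<dots> = ?K ^ T * walk k (\<lambda>x. exp (l * ?h x)) z"
    by (rule walk_mult_left)
  also have "\<dots> \<le> ?K ^ T * (?K * exp (l * walk k ?h z))"
    using h by (intro mult_left_mono walk_exp_step[where \<delta> = \<delta>] d k l) auto
  finally show ?case by (simp add: mult_ac)
qed

text \<open>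
  By the parallelogram law each step increases the mean square distance to any fixed point by
  exactly \<open>1\<close>.
\<close>
lemma walk_iterate_dist2:
  assumes k: "k > 0"
  shows "(walk k ^^ T) (\<lambda>x. (edist k x y)\<^sup>2) z = (edist k z y)\<^sup>2 + real T"
proof (induction T arbitrary: z)
  case 0
  show ?case by simp
next
  case (Suc T)
  have *: "(edist k (z + on_axis j 1) y)\<^sup>2 + (edist k (z + on_axis j (- 1)) y)\<^sup>2
      = 2 * (edist k z y)\<^sup>2 + 2" if "j < k" for j
  proof -
    have "(edist k (z + on_axis j 1) y)\<^sup>2 + (edist k (z + on_axis j (- 1)) y)\<^sup>2
        = (\<Sum>i<k. 2 * (real_of_int (z i - y i))\<^sup>2 + (if i = j then 2 else 0))"
      unfolding edist_power2 sum.distrib[symmetric]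
      by (intro sum.cong) (auto simp: on_axis_def power2_eq_square algebra_simps)
    also have "\<dots> = 2 * (edist k z y)\<^sup>2 + 2"
      using that by (simp add: sum.distrib edist_power2 sum_distrib_left)
    finally show ?thesis .
  qed
  have "(walk k ^^ T) (\<lambda>x. (edist k x y)\<^sup>2) = (\<lambda>x. (edist k x y)\<^sup>2 + real T)"
    by (rule ext) (rule Suc.IH)
  then have "(walk k ^^ Suc T) (\<lambda>x. (edist k x y)\<^sup>2) z = walk k (\<lambda>x. (edist k x y)\<^sup>2 + real T) z"
    by simp
  also have "\<dots> = (\<Sum>j<k. ((edist k (z + on_axis j 1) y)\<^sup>2 + (edist k (z + on_axis j (- 1)) y)\<^sup>2) + 2 * real T) / (2 * real k)"
    by (simp add: walk_eq algebra_simps)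
  also have "\<dots> = (\<Sum>j<k. (2 * (edist k z y)\<^sup>2 + 2) + 2 * real T) / (2 * real k)"
    using * by simp
  also have "\<dots> = (edist k z y)\<^sup>2 + real (Suc T)"
    using k by (simp add: field_simps)
  finally show ?case .
qed

text \<open>
  The extensional function space makes the box finite; its points are \<open>undefined\<close> beyond \<open>k\<close>,
  which steps along the axes \<open>j < k\<close> leave unchanged.
\<close>
definition lattice_box :: "nat \<Rightarrow> nat \<Rightarrow> (nat \<Rightarrow> int) set"
  where "lattice_box k N = PiE {..<k} (\<lambda>_. {- int N..int N})"

lemma finite_lattice_box [simp]: "finite (lattice_box k N)"
  by (simp add: lattice_box_def finite_PiE)

lemma card_lattice_box: "card (lattice_box k N) = (2 * N + 1) ^ k"
  by (simp add: lattice_box_def card_PiE) (simp add: nat_add_distrib nat_mult_distrib)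

lemma add_on_axis_in_lattice_box:
  assumes "z \<in> lattice_box k M" "j < k" "\<bar>t\<bar> \<le> 1"
  shows "z + on_axis j t \<in> lattice_box k (Suc M)"
  unfolding lattice_box_def
proof (rule PiE_I)
  fix i assume "i \<in> {..<k}"
  then have "z i \<in> {- int M..int M}"
    using PiE_mem[of z "{..<k}" "\<lambda>_. {- int M..int M}" i] assms(1) by (simp add: lattice_box_def)
  moreover have "\<bar>on_axis j t i\<bar> \<le> 1" using assms(3) by (simp add: on_axis_def)
  ultimately show "(z + on_axis j t) i \<in> {- int (Suc M)..int (Suc M)}"
    by (simp add: abs_le_iff)
next
  fix i assume i: "i \<notin> {..<k}"
  then have "z i = undefined"
    using PiE_arb[of z "{..<k}" _ i] assms(1) by (simp add: lattice_box_def)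
  then show "(z + on_axis j t) i = undefined"
    using i assms(2) by (auto simp: on_axis_def)
qed

text \<open>
  The iterated walk operator, evaluated at one point, is the expectation with respect to the
  distribution of the position after \<open>T\<close> steps, and this distribution lives on a box.
\<close>
lemma walk_weights:
  assumes "k > 0" "z \<in> lattice_box k M"
  shows "\<exists>w. (\<forall>x. w x \<ge> 0) \<and> (\<Sum>x\<in>lattice_box k (M + T). w x) = 1 \<and>
    (\<forall>\<phi>. (walk k ^^ T) \<phi> z = (\<Sum>x\<in>lattice_box k (M + T). w x * \<phi> x))"
  using assms(2)
proof (induction T arbitrary: M z)
  case 0
  have "(\<Sum>x\<in>lattice_box k M. (if x = z then 1 else 0) * \<phi> x) = \<phi> z" for \<phi> :: "(nat \<Rightarrow> int) \<Rightarrow> real"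
  proof -
    have "(\<Sum>x\<in>lattice_box k M. (if x = z then 1 else 0) * \<phi> x)
        = (\<Sum>x\<in>lattice_box k M. if x = z then \<phi> x else 0)"
      by (intro sum.cong) auto
    then show ?thesis using 0 by simp
  qed
  then show ?case
    using 0 by (intro exI[of _ "\<lambda>x. if x = z then 1 else 0"]) auto
next
  case (Suc T)
  let ?W = "{..<k} \<times> {1, - 1 :: int}" and ?B = "lattice_box k (M + Suc T)"
  have "\<forall>a\<in>?W. \<exists>w. (\<forall>x. w x \<ge> 0) \<and> sum w ?B = 1 \<and>
      (\<forall>\<phi>. (walk k ^^ T) \<phi> (z + on_axis (fst a) (snd a)) = (\<Sum>x\<in>?B. w x * \<phi> x))"
    using Suc.IH[OF add_on_axis_in_lattice_box[OF Suc.prems]] by fastforce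
  then obtain w where w: "\<forall>a\<in>?W. (\<forall>x. w a x \<ge> 0) \<and> sum (w a) ?B = 1 \<and>
      (\<forall>\<phi>. (walk k ^^ T) \<phi> (z + on_axis (fst a) (snd a)) = (\<Sum>x\<in>?B. w a x * \<phi> x))"
    by metis
  define u where "u x = (\<Sum>a\<in>?W. w a x) / (2 * real k)" for x
  have cW: "real (card ?W) = 2 * real k" by (simp add: card_cartesian_product)
  show ?case
  proof (intro exI[of _ u] conjI allI)
    show "u x \<ge> 0" for x
      using w unfolding u_def by (intro divide_nonneg_nonneg sum_nonneg) auto
    have "sum u ?B = (\<Sum>a\<in>?W. sum (w a) ?B) / (2 * real k)"
      unfolding u_def sum_divide_distrib[symmetric] by (subst sum.swap) simp
    also have "(\<Sum>a\<in>?W. sum (w a) ?B) = (\<Sum>a\<in>?W. 1)"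
      by (rule sum.cong) (use w in blast)+
    also have "(\<Sum>a\<in>?W. 1) / (2 * real k) = 1" using cW assms(1) by simp
    finally show "sum u ?B = 1" .
  next
    fix \<phi>
    have "(walk k ^^ Suc T) \<phi> z
        = (\<Sum>a\<in>?W. (walk k ^^ T) \<phi> (z + on_axis (fst a) (snd a))) / (2 * real k)"
      using cW by (simp add: walk_def shift_avg_def split_def)
    also have "\<dots> = (\<Sum>a\<in>?W. \<Sum>x\<in>?B. w a x * \<phi> x) / (2 * real k)"
      using w by (intro arg_cong2[where f = "(/)"] sum.cong) auto
    also have "\<dots> = (\<Sum>x\<in>?B. u x * \<phi> x)"
      unfolding u_def by (subst sum.swap) (simp add: sum_distrib_right sum_divide_distrib)
    finally show "(walk k ^^ Suc T) \<phi> z = (\<Sum>x\<in>?B. u x * \<phi> x)" .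
  qed
qed

section \<open>Concentration at the end of the walk\<close>

text \<open>
  The summand \<open>1\<close> accounts for the smoothing error, \<open>2 * p powr p * exp 15\<close> for the exponential
  moments at \<open>1 / r\<close> and \<open>- 1 / r\<close>, and \<open>2 powr p\<close> is the cost of adding the two.
\<close>
definition walk_moment_const :: "real \<Rightarrow> real"
  where "walk_moment_const p = 2 powr p * (2 * p powr p * exp 15 + 1)"

lemma walk_moment_const_pos: "p > 0 \<Longrightarrow> walk_moment_const p > 0"
  by (auto simp: walk_moment_const_def intro!: mult_pos_pos add_nonneg_pos)

text \<open>
  After \<open>T\<close> steps the position is spread over a distance of order \<open>sqrt T\<close>, but a real-valued
  Lipschitz function \<open>F\<close> only fluctuates by \<open>r = sqrt (T / k)\<close>. The function is smoothed to \<open>g\<close>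
  at the cost of an error of at most \<open>r\<close>, and the exponential moment of \<open>g\<close> at \<open>l = 1 / r\<close> picks
  up the factor \<open>exp (15 * l\<^sup>2 / k)\<close> in each step, which is \<open>exp 15\<close> in total.
\<close>
lemma walk_concentration:
  assumes p: "p > 0" and k: "k > 0" and T: "T \<ge> 576 * k ^ 7"
    and F: "lattice_lipschitz k 1 F"
    and w: "\<And>x. w x \<ge> 0" "sum w B = 1"
      "\<And>\<phi>. (walk k ^^ T) \<phi> z = (\<Sum>x\<in>B. w x * \<phi> x)"
  shows "\<exists>c. (\<Sum>x\<in>B. w x * \<bar>F x - c\<bar> powr p) \<le> walk_moment_const p * (real T / real k) powr (p / 2)"
proof -
  define r where "r = sqrt (real T / real k)"
  \<comment> \<open>The smallest side length for which the gradient bound applies. The smoothing error is then at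
      most \<open>k * b = 24 * k ^ 3\<close>, and \<open>T \<ge> 576 * k ^ 7\<close> says that this is at most \<open>r\<close>.\<close>
  define b where "b = 24 * k\<^sup>2"
  have Tk: "real T / real k \<ge> 576 * real k ^ 6"
  proof -
    have "real T \<ge> real (576 * k ^ 7)" using T of_nat_mono by blast
    also have "real (576 * k ^ 7) = 576 * real k ^ 6 * real k"
      by (simp add: power_Suc[symmetric] eval_nat_numeral)
    finally show ?thesis using k by (simp add: field_simps)
  qed
  have r24: "r \<ge> 24 * real k ^ 3"
    unfolding r_def using Tk
    by (intro real_le_rsqrt) (simp add: power_mult_distrib flip: power_mult)
  have "24 * real k ^ 3 \<ge> 24 * 1"
    using k by (intro mult_left_mono one_le_power) auto
  then have r1: "r \<ge> 1" using r24 by linarith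
  have r2: "r\<^sup>2 = real T / real k" by (simp add: r_def)
  have rp: "r powr p = (real T / real k) powr (p / 2)"
    by (simp add: r_def powr_half_sqrt[symmetric] powr_powr)
  have b0: "b > 0" using k by (simp add: b_def)
  obtain g where g: "lattice_lipschitz k 1 g"
    "\<forall>j<k. lattice_lipschitz k (2 / real b) (pdiff j g)"
    "\<forall>x. \<bar>g x - F x\<bar> \<le> real k * real b"
    using exists_smoothing[OF b0 F, of k] by blast
  have d: "2 / real b \<ge> 0" "12 * (real k)\<^sup>2 * (2 / real b) \<le> 1"
    using k by (auto simp: b_def)
  have gF: "\<bar>F x - g x\<bar> \<le> r" for x
  proof -
    have "real k * real b = 24 * real k ^ 3"
      by (simp add: b_def power2_eq_square power3_eq_cube)
    then show ?thesis using g(3)[rule_format, of x] r24 by linarith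
  qed
  define c where "c = (walk k ^^ T) g z"
  have mgf: "(\<Sum>x\<in>B. w x * exp (l * (g x - c))) \<le> exp 15" if l: "\<bar>l\<bar> = 1 / r" for l
  proof -
    have l2: "l\<^sup>2 = real k / real T"
      using l r2 by (metis power2_abs power_one_over inverse_eq_divide inverse_divide)
    have "(\<Sum>x\<in>B. w x * exp (l * (g x - c))) = exp (- l * c) * (\<Sum>x\<in>B. w x * exp (l * g x))"
      by (simp add: sum_distrib_left right_diff_distrib exp_diff exp_minus field_simps)
    also have "\<dots> = exp (- l * c) * (walk k ^^ T) (\<lambda>x. exp (l * g x)) z"
      by (simp add: w(3))
    also have "\<dots> \<le> exp (- l * c) * (exp (15 * l\<^sup>2 / real k) ^ T * exp (l * c))"
      unfolding c_def
      by (intro mult_left_mono walk_iterate_exp[OF g(1) _ d k]) (use g(2) l r1 in auto)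
    also have "\<dots> = exp (15 * l\<^sup>2 / real k) ^ T"
      by (simp add: exp_minus)
    also have "\<dots> = exp (real T * (15 * l\<^sup>2 / real k))"
      by (rule exp_of_nat_mult[symmetric])
    also have "\<dots> \<le> exp 15"
      using k by (simp add: l2)
    finally show ?thesis .
  qed
  have pt: "\<bar>F x - c\<bar> powr p \<le> 2 powr p * r powr p *
      (p powr p * (exp (1 / r * (g x - c)) + exp (- 1 / r * (g x - c))) + 1)" for x
  proof -
    let ?e = "exp (1 / r * (g x - c)) + exp (- 1 / r * (g x - c))"
    have "\<bar>F x - g x\<bar> powr p \<le> r powr p"
      using gF p by (intro powr_mono2) auto
    moreover have "\<bar>g x - c\<bar> powr p \<le> r powr p * (p powr p * ?e)"
    proof -
      have "\<bar>g x - c\<bar> powr p = r powr p * \<bar>1 / r * (g x - c)\<bar> powr p"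
        using r1 by (simp add: abs_mult powr_mult[symmetric])
      also have "\<dots> \<le> r powr p * (p powr p * ?e)"
        using abs_powr_le_exp[OF p, of "1 / r * (g x - c)"] by (intro mult_left_mono) auto
      finally show ?thesis .
    qed
    ultimately have "2 powr p * (\<bar>g x - c\<bar> powr p + \<bar>F x - g x\<bar> powr p)
        \<le> 2 powr p * (r powr p * (p powr p * ?e) + r powr p)"
      by (intro mult_left_mono add_mono) auto
    then show ?thesis
      using abs_add_powr_le[OF p, of "g x - c" "F x - g x"] by (simp add: algebra_simps)
  qed
  have "(\<Sum>x\<in>B. w x * \<bar>F x - c\<bar> powr p)
      \<le> (\<Sum>x\<in>B. w x * (2 powr p * r powr p *
          (p powr p * (exp (1 / r * (g x - c)) + exp (- 1 / r * (g x - c))) + 1)))"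
    by (intro sum_mono mult_left_mono pt w)
  also have "\<dots> = 2 powr p * r powr p *
      (p powr p * ((\<Sum>x\<in>B. w x * exp (1 / r * (g x - c))) + (\<Sum>x\<in>B. w x * exp (- 1 / r * (g x - c)))) + sum w B)"
    by (simp add: sum_distrib_left sum_distrib_right sum.distrib distrib_left distrib_right mult_ac)
  also have "\<dots> \<le> 2 powr p * r powr p * (p powr p * (exp 15 + exp 15) + 1)"
    unfolding w(2) using r1
    by (intro mult_left_mono add_mono mgf) auto
  also have "\<dots> = walk_moment_const p * (real T / real k) powr (p / 2)"
    by (simp add: walk_moment_const_def rp algebra_simps)
  finally show ?thesis by blast
qed

text \<open>
  The smoothing and the gradient bound look at points outside the given set, so functions on a
  box have to be extended to the whole lattice without increasing the Lipschitz constant.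
\<close>
lemma McShane_extension:
  assumes fin: "finite G" "G \<noteq> {}" and f: "\<And>x y. x \<in> G \<Longrightarrow> y \<in> G \<Longrightarrow> \<bar>f x - f y\<bar> \<le> edist k x y"
  shows "\<exists>F. lattice_lipschitz k 1 F \<and> (\<forall>x\<in>G. F x = f x)"
proof (intro exI conjI ballI)
  define F where "F x = Min ((\<lambda>a. f a + edist k x a) ` G)" for x
  have le: "F x \<le> f a + edist k x a" if "a \<in> G" for a x
    unfolding F_def using fin that by (intro Min_le) auto
  have ex: "\<exists>a\<in>G. F x = f a + edist k x a" for x
  proof -
    have "F x \<in> (\<lambda>a. f a + edist k x a) ` G"
      unfolding F_def using fin by (intro Min_in) auto
    then show ?thesis by blast
  qed
  have half: "F x - F y \<le> edist k x y" for x y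
  proof -
    obtain a where a: "a \<in> G" "F y = f a + edist k y a" using ex by blast
    show ?thesis using le[OF a(1), of x] a(2) edist_triangle[of k x a y] by linarith
  qed
  show "lattice_lipschitz k 1 F"
    unfolding lattice_lipschitz_def
    using half edist_commute by (simp add: abs_le_iff) (metis minus_diff_eq)
  fix x assume x: "x \<in> G"
  obtain a where a: "a \<in> G" "F x = f a + edist k x a" using ex by blast
  show "F x = f x"
    using le[OF x, of x] a f[OF x a(1)] by simp
qed

section \<open>Embeddings of lattice boxes\<close>

lemma lp_fin_dist_powr:
  assumes "p > 0"
  shows "lp_fin_dist p m u v powr p = (\<Sum>i<m. \<bar>u i - v i\<bar> powr p)"
  using assms by (simp add: lp_fin_dist_def lp_fin_norm_def powr_powr sum_nonneg)

lemma coordinate_le_lp_fin_dist: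
  assumes "p > 0" "i < m"
  shows "\<bar>u i - v i\<bar> \<le> lp_fin_dist p m u v"
proof -
  have "\<bar>u i - v i\<bar> powr p \<le> lp_fin_dist p m u v powr p"
    unfolding lp_fin_dist_powr[OF assms(1)]
    by (rule member_le_sum[of i "{..<m}" "\<lambda>i. \<bar>u i - v i\<bar> powr p"]) (use assms in auto)
  moreover have "lp_fin_dist p m u v \<ge> 0" by (simp add: lp_fin_dist_def lp_fin_norm_def)
  ultimately show ?thesis
    using assms(1) powr_less_mono2[of p "lp_fin_dist p m u v" "\<bar>u i - v i\<bar>"] by linarith
qed

lemma weighted_sum_affine:
  fixes w a :: "'a \<Rightarrow> real"
  shows "(\<Sum>y\<in>B. w y * (C * (a y + b))) = C * ((\<Sum>y\<in>B. w y * a y) + sum w B * b)"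
  by (simp add: sum_distrib_left sum_distrib_right sum.distrib distrib_left mult_ac)

text \<open>
  Take two independent endpoints of the walk. Their mean distance to the power \<open>p\<close> is at least
  \<open>T powr (p / 2)\<close>. On the other hand each of the \<open>m\<close> coordinates of \<open>f\<close> is an \<open>L\<close>-Lipschitz
  real function, hence contributes at most a constant times \<open>(L * sqrt (T / k)) powr p\<close>.
  Comparing the two forces \<open>m\<close> to be of order \<open>k powr (p / 2)\<close>.
\<close>
lemma lattice_box_dimension_bound:
  fixes f :: "(nat \<Rightarrow> int) \<Rightarrow> nat \<Rightarrow> real"
  assumes p: "p > 2" and k: "k > 0" and T: "T \<ge> 576 * k ^ 7" and s: "s > 0" "L > 0"
    and lower: "\<And>x y. x \<in> lattice_box k T \<Longrightarrow> y \<in> lattice_box k T \<Longrightarrow>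
      s * edist k x y \<le> lp_fin_dist p m (f x) (f y)"
    and upper: "\<And>x y. x \<in> lattice_box k T \<Longrightarrow> y \<in> lattice_box k T \<Longrightarrow>
      lp_fin_dist p m (f x) (f y) \<le> L * edist k x y"
  shows "(s / L) powr p / (2 powr p * (2 * walk_moment_const p)) * real k powr (p / 2) \<le> real m"
proof -
  let ?B = "lattice_box k T"
  define z :: "nat \<Rightarrow> int" where "z = (\<lambda>j\<in>{..<k}. 0)"
  have z: "z \<in> lattice_box k 0" by (simp add: z_def lattice_box_def)
  have p0: "p > 0" using p by simp
  obtain w where w: "\<And>x. w x \<ge> 0" "sum w ?B = 1"
      "\<And>\<phi>. (walk k ^^ T) \<phi> z = (\<Sum>x\<in>?B. w x * \<phi> x)"
    using walk_weights[OF k z, of T] by auto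
  have T0: "real T > 0" using T k by (metis zero_less_power mult_pos_pos of_nat_0_less_iff less_le_trans zero_less_numeral)
  define V where "V = (real T / real k) powr (p / 2)"
  have V: "V > 0" using T0 k by (simp add: V_def)
  have "\<exists>c. (\<Sum>x\<in>?B. w x * \<bar>f x i / L - c\<bar> powr p) \<le> walk_moment_const p * V" if i: "i < m" for i
  proof -
    have "\<exists>F. lattice_lipschitz k 1 F \<and> (\<forall>x\<in>?B. F x = f x i / L)"
    proof (rule McShane_extension)
      show "?B \<noteq> {}" using w(2) by auto
      fix x y assume xy: "x \<in> ?B" "y \<in> ?B"
      have "\<bar>f x i - f y i\<bar> \<le> L * edist k x y"
        using coordinate_le_lp_fin_dist[OF p0 i] upper[OF xy] by (meson order.trans)
      then show "\<bar>f x i / L - f y i / L\<bar> \<le> edist k x y"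
        using s by (simp add: abs_divide field_simps flip: diff_divide_distrib)
    qed simp
    then obtain F where F: "lattice_lipschitz k 1 F" "\<forall>x\<in>?B. F x = f x i / L" by blast
    then show ?thesis using walk_concentration[OF p0 k T F(1) w] by (simp add: V_def)
  qed
  then obtain c where c: "\<And>i. i < m \<Longrightarrow>
      (\<Sum>x\<in>?B. w x * \<bar>f x i / L - c i\<bar> powr p) \<le> walk_moment_const p * V"
    by metis
  have far: "s powr p * real T powr (p / 2) \<le> (\<Sum>y\<in>?B. w y * lp_fin_dist p m (f y) (f x) powr p)"
    if x: "x \<in> ?B" for x
  proof -
    have "real T powr (p / 2) \<le> ((walk k ^^ T) (\<lambda>y. (edist k y x)\<^sup>2) z) powr (p / 2)"
      unfolding walk_iterate_dist2[OF k] using p by (intro powr_mono2) auto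
    also have "\<dots> = (\<Sum>y\<in>?B. w y * (edist k y x)\<^sup>2) powr (p / 2)" by (simp add: w(3))
    also have "\<dots> \<le> (\<Sum>y\<in>?B. w y * ((edist k y x)\<^sup>2) powr (p / 2))"
      by (rule powr_Jensen) (use p w in auto)
    also have "\<dots> = (\<Sum>y\<in>?B. w y * edist k y x powr p)"
      by (intro sum.cong refl arg_cong2[where f = "(*)"])
        (auto simp: powr_powr simp flip: powr_numeral)
    finally have "s powr p * real T powr (p / 2) \<le> s powr p * (\<Sum>y\<in>?B. w y * edist k y x powr p)"
      by (intro mult_left_mono) auto
    also have "\<dots> = (\<Sum>y\<in>?B. w y * (s * edist k y x) powr p)"
      using s by (simp add: sum_distrib_left powr_mult mult_ac)
    also have "\<dots> \<le> (\<Sum>y\<in>?B. w y * lp_fin_dist p m (f y) (f x) powr p)"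
      using lower[OF _ x] s p w by (intro sum_mono mult_left_mono powr_mono2) auto
    finally show ?thesis .
  qed
  define e where "e x i = \<bar>f x i / L - c i\<bar> powr p" for x i
  have close: "lp_fin_dist p m (f y) (f x) powr p \<le> L powr p * 2 powr p * ((\<Sum>i<m. e y i) + (\<Sum>i<m. e x i))" for x y
  proof -
    have "lp_fin_dist p m (f y) (f x) powr p = (\<Sum>i<m. \<bar>f y i - f x i\<bar> powr p)"
      by (rule lp_fin_dist_powr[OF p0])
    also have "\<dots> \<le> (\<Sum>i<m. L powr p * (2 powr p * (e y i + e x i)))"
    proof (intro sum_mono)
      fix i
      have "\<bar>f y i - f x i\<bar> = L * \<bar>(f y i / L - c i) + (c i - f x i / L)\<bar>"
        using s by (simp add: abs_divide flip: diff_divide_distrib)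
      then have "\<bar>f y i - f x i\<bar> powr p = L powr p * \<bar>(f y i / L - c i) + (c i - f x i / L)\<bar> powr p"
        using s by (simp add: powr_mult)
      also have "\<dots> \<le> L powr p * (2 powr p * (e y i + \<bar>c i - f x i / L\<bar> powr p))"
        unfolding e_def by (intro mult_left_mono abs_add_powr_le p0) auto
      finally show "\<bar>f y i - f x i\<bar> powr p \<le> L powr p * (2 powr p * (e y i + e x i))"
        by (simp add: e_def abs_minus_commute)
    qed
    also have "\<dots> = L powr p * 2 powr p * ((\<Sum>i<m. e y i) + (\<Sum>i<m. e x i))"
      unfolding sum_distrib_left[symmetric] sum.distrib by (simp add: mult.assoc)
    finally show ?thesis .
  qed
  define E where "E = (\<Sum>x\<in>?B. w x * (\<Sum>i<m. e x i))"
  have E: "E \<le> real m * (walk_moment_const p * V)"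
  proof -
    have "E = (\<Sum>i<m. \<Sum>x\<in>?B. w x * e x i)"
      unfolding E_def sum_distrib_left by (rule sum.swap)
    also have "\<dots> \<le> (\<Sum>i<m. walk_moment_const p * V)"
      by (intro sum_mono) (use c in \<open>auto simp: e_def\<close>)
    finally show ?thesis by simp
  qed
  have "s powr p * real T powr (p / 2) = (\<Sum>x\<in>?B. w x * (s powr p * real T powr (p / 2)))"
    using w(2) by (simp flip: sum_distrib_right)
  also have "\<dots> \<le> (\<Sum>x\<in>?B. w x * (\<Sum>y\<in>?B. w y * lp_fin_dist p m (f y) (f x) powr p))"
    by (intro sum_mono mult_left_mono far w)
  also have "\<dots> \<le> (\<Sum>x\<in>?B. w x * (\<Sum>y\<in>?B. w y *
      (L powr p * 2 powr p * ((\<Sum>i<m. e y i) + (\<Sum>i<m. e x i)))))"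
    by (intro sum_mono mult_left_mono close w)
  also have "\<dots> = (\<Sum>x\<in>?B. w x * (L powr p * 2 powr p * (E + (\<Sum>i<m. e x i))))"
  proof (intro sum.cong refl arg_cong2[where f = "(*)"])
    fix x
    have "(\<Sum>y\<in>?B. w y * (L powr p * 2 powr p * ((\<Sum>i<m. e y i) + (\<Sum>i<m. e x i))))
        = L powr p * 2 powr p * (E + sum w ?B * (\<Sum>i<m. e x i))"
      unfolding E_def by (rule weighted_sum_affine)
    then show "(\<Sum>y\<in>?B. w y * (L powr p * 2 powr p * ((\<Sum>i<m. e y i) + (\<Sum>i<m. e x i))))
        = L powr p * 2 powr p * (E + (\<Sum>i<m. e x i))" by (simp add: w(2))
  qed
  also have "\<dots> = L powr p * 2 powr p * (sum w ?B * E + E)"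
    using weighted_sum_affine[of w "L powr p * 2 powr p" "\<lambda>x. \<Sum>i<m. e x i" E ?B]
    by (simp add: E_def[symmetric] add.commute)
  also have "\<dots> = L powr p * 2 powr p * 2 * E" by (simp add: w(2))
  also have "\<dots> \<le> L powr p * 2 powr p * 2 * (real m * (walk_moment_const p * V))"
    using E by (intro mult_left_mono) auto
  finally have fin: "s powr p * real T powr (p / 2)
      \<le> L powr p * 2 powr p * 2 * (real m * (walk_moment_const p * V))" .
  have TV: "real T powr (p / 2) = V * real k powr (p / 2)"
    using k by (simp add: V_def powr_divide)
  have "V * (s powr p * real k powr (p / 2)) \<le> V * (L powr p * 2 powr p * 2 * (real m * walk_moment_const p))"
    using fin unfolding TV by (simp add: mult_ac)
  then have "s powr p * real k powr (p / 2) \<le> L powr p * 2 powr p * 2 * (real m * walk_moment_const p)"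
    using V by simp
  then show ?thesis
    using s walk_moment_const_pos[OF p0] by (simp add: powr_divide field_simps)
qed

section \<open>Euclidean space inside the sequence space\<close>

text \<open>
  The set \<open>S\<close> plays the role of a choice of signs, and summing over \<open>Pow A\<close> that of averaging
  over independent random signs.
\<close>
definition signed_sum :: "'a set \<Rightarrow> 'a set \<Rightarrow> ('a \<Rightarrow> real) \<Rightarrow> real"
  where "signed_sum A S x = (\<Sum>j\<in>A. if j \<in> S then x j else - x j)"

lemma sum_Pow_insert:
  assumes "finite A" "a \<notin> A"
  shows "(\<Sum>S\<in>Pow (insert a A). g S) = (\<Sum>S\<in>Pow A. g S + g (insert a S))"
proof -
  have "inj_on (insert a) (Pow A)" using assms(2) by (auto simp: inj_on_def)
  moreover have "Pow A \<inter> insert a ` Pow A = {}" using assms(2) by auto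
  ultimately show ?thesis
    using assms(1) by (simp add: Pow_insert sum.union_disjoint sum.reindex sum.distrib)
qed

lemma signed_sum_insert:
  assumes "finite A" "a \<notin> A" "S \<subseteq> A"
  shows "signed_sum (insert a A) S x = - x a + signed_sum A S x"
    and "signed_sum (insert a A) (insert a S) x = x a + signed_sum A S x"
proof -
  have "a \<notin> S" using assms by auto
  then show "signed_sum (insert a A) S x = - x a + signed_sum A S x"
    using assms by (simp add: signed_sum_def)
  have "(\<Sum>j\<in>A. if j \<in> insert a S then x j else - x j) = (\<Sum>j\<in>A. if j \<in> S then x j else - x j)"
    using assms(2) by (intro sum.cong) auto
  then show "signed_sum (insert a A) (insert a S) x = x a + signed_sum A S x"
    using assms by (simp add: signed_sum_def)
qed

text \<open>
  Orthogonality of the signs. The shift \<open>t\<close> collects the terms whose sign is already fixed, which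
  makes the induction on \<open>A\<close> possible.
\<close>
lemma sum_signed_sum_power2:
  assumes "finite A"
  shows "(\<Sum>S\<in>Pow A. (t + signed_sum A S x)\<^sup>2) = 2 ^ card A * (t\<^sup>2 + (\<Sum>j\<in>A. (x j)\<^sup>2))"
  using assms
proof (induction A arbitrary: t rule: finite_induct)
  case empty
  show ?case by (simp add: signed_sum_def)
next
  case (insert a A)
  have "(\<Sum>S\<in>Pow (insert a A). (t + signed_sum (insert a A) S x)\<^sup>2)
      = (\<Sum>S\<in>Pow A. ((t - x a) + signed_sum A S x)\<^sup>2 + ((t + x a) + signed_sum A S x)\<^sup>2)"
    unfolding sum_Pow_insert[OF insert.hyps]
    by (intro sum.cong refl) (use insert.hyps in \<open>auto simp: signed_sum_insert algebra_simps\<close>)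
  also have "\<dots> = 2 ^ card A * ((t - x a)\<^sup>2 + (\<Sum>j\<in>A. (x j)\<^sup>2)) + 2 ^ card A * ((t + x a)\<^sup>2 + (\<Sum>j\<in>A. (x j)\<^sup>2))"
    unfolding sum.distrib insert.IH ..
  also have "\<dots> = 2 ^ card (insert a A) * (t\<^sup>2 + (\<Sum>j\<in>insert a A. (x j)\<^sup>2))"
    using insert.hyps by (simp add: power2_eq_square algebra_simps)
  finally show ?case .
qed

lemma exp_add_exp_minus_le: "exp t + exp (- t) \<le> 2 * exp (t\<^sup>2)" for t :: real
proof (cases "\<bar>t\<bar> \<le> 1")
  case True
  then have "exp t \<le> 1 + t + t\<^sup>2" "exp (- t) \<le> 1 - t + t\<^sup>2"
    using exp_le_quadratic[of t] exp_le_quadratic[of "- t"] by simp_all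
  moreover have "1 + t\<^sup>2 \<le> exp (t\<^sup>2)" by (rule exp_ge_add_one_self)
  ultimately show ?thesis by linarith
next
  case False
  then have "\<bar>t\<bar> * 1 \<le> \<bar>t\<bar> * \<bar>t\<bar>" by (intro mult_left_mono) auto
  then have "\<bar>t\<bar> \<le> t\<^sup>2" by (simp add: power2_eq_square)
  then have "exp t \<le> exp (t\<^sup>2)" "exp (- t) \<le> exp (t\<^sup>2)" by auto
  then show ?thesis by linarith
qed

lemma sum_exp_signed_sum_le:
  assumes "finite A"
  shows "(\<Sum>S\<in>Pow A. exp (signed_sum A S x)) \<le> 2 ^ card A * exp (\<Sum>j\<in>A. (x j)\<^sup>2)"
  using assms
proof (induction A rule: finite_induct)
  case empty
  show ?case by (simp add: signed_sum_def)
next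
  case (insert a A)
  have "(\<Sum>S\<in>Pow (insert a A). exp (signed_sum (insert a A) S x))
      = (\<Sum>S\<in>Pow A. (exp (x a) + exp (- x a)) * exp (signed_sum A S x))"
    unfolding sum_Pow_insert[OF insert.hyps]
    by (intro sum.cong refl)
      (use insert.hyps in \<open>auto simp: signed_sum_insert distrib_right exp_diff exp_minus exp_add field_simps\<close>)
  also have "\<dots> = (exp (x a) + exp (- x a)) * (\<Sum>S\<in>Pow A. exp (signed_sum A S x))"
    by (simp add: sum_distrib_left)
  also have "\<dots> \<le> (2 * exp ((x a)\<^sup>2)) * (2 ^ card A * exp (\<Sum>j\<in>A. (x j)\<^sup>2))"
    by (intro mult_mono exp_add_exp_minus_le insert.IH sum_nonneg) auto
  also have "\<dots> = 2 ^ card (insert a A) * exp (\<Sum>j\<in>insert a A. (x j)\<^sup>2)"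
    using insert.hyps by (simp add: exp_add)
  finally show ?case .
qed

lemma signed_sum_scale: "signed_sum A S (\<lambda>j. c * x j) = c * signed_sum A S x"
  unfolding signed_sum_def sum_distrib_left by (intro sum.cong) auto

lemma signed_sum_diff: "signed_sum A S x - signed_sum A S y = signed_sum A S (\<lambda>j. x j - y j)"
  unfolding signed_sum_def sum_subtractf[symmetric] by (intro sum.cong) auto

text \<open>
  After scaling \<open>x\<close> to unit length, the exponential moments of the signed sums are bounded by
  a constant, and they dominate the \<open>p\<close>-th moment.
\<close>
lemma Khintchine_upper:
  assumes "finite A" "p > 0"
  shows "(\<Sum>S\<in>Pow A. \<bar>signed_sum A S x\<bar> powr p / 2 ^ card A) \<le> 2 * p powr p * exp 1 * L2_set x A powr p"
proof (cases "L2_set x A = 0")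
  case True
  then have "signed_sum A S x = 0" for S
    using assms by (auto simp: L2_set_eq_0_iff signed_sum_def intro!: sum.neutral)
  then show ?thesis using True by simp
next
  case False
  define r where "r = L2_set x A"
  have r: "r > 0" using False by (simp add: r_def less_le)
  have "(\<Sum>j\<in>A. (x j)\<^sup>2) = r\<^sup>2" by (simp add: r_def L2_set_def sum_nonneg)
  then have unit: "(\<Sum>j\<in>A. (c / r * x j)\<^sup>2) = c\<^sup>2" for c
    unfolding power_mult_distrib sum_distrib_left[symmetric] using r by (simp add: power_divide)
  have E: "(\<Sum>S\<in>Pow A. exp (c / r * signed_sum A S x)) \<le> 2 ^ card A * exp 1" if "c\<^sup>2 = 1" for c
    using sum_exp_signed_sum_le[OF assms(1), of "\<lambda>j. c / r * x j"]
    unfolding unit signed_sum_scale that .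
  have "(\<Sum>S\<in>Pow A. \<bar>signed_sum A S x\<bar> powr p / 2 ^ card A)
      = r powr p / 2 ^ card A * (\<Sum>S\<in>Pow A. \<bar>1 / r * signed_sum A S x\<bar> powr p)"
    using r by (simp add: sum_distrib_left abs_mult powr_divide)
  also have "\<dots> \<le> r powr p / 2 ^ card A * (\<Sum>S\<in>Pow A. p powr p *
      (exp (1 / r * signed_sum A S x) + exp (- (1 / r * signed_sum A S x))))"
    by (intro mult_left_mono sum_mono abs_powr_le_exp assms) auto
  also have "\<dots> = r powr p / 2 ^ card A * (p powr p * ((\<Sum>S\<in>Pow A. exp (1 / r * signed_sum A S x))
      + (\<Sum>S\<in>Pow A. exp (- 1 / r * signed_sum A S x))))"
    by (simp add: sum.distrib flip: sum_distrib_left)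
  also have "\<dots> \<le> r powr p / 2 ^ card A * (p powr p * (2 ^ card A * exp 1 + 2 ^ card A * exp 1))"
    by (intro mult_left_mono add_mono E) auto
  also have "\<dots> = 2 * p powr p * exp 1 * L2_set x A powr p"
    by (simp add: r_def)
  finally show ?thesis .
qed

text \<open>
  For \<open>p > 2\<close> the \<open>p\<close>-th mean dominates the quadratic mean, which is exact by orthogonality.
\<close>
lemma Khintchine_lower:
  assumes "finite A" "p > 2"
  shows "L2_set x A powr p \<le> (\<Sum>S\<in>Pow A. \<bar>signed_sum A S x\<bar> powr p / 2 ^ card A)"
proof -
  have "L2_set x A powr p = (\<Sum>j\<in>A. (x j)\<^sup>2) powr (p / 2)"
    by (simp add: L2_set_def powr_half_sqrt[symmetric] powr_powr sum_nonneg)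
  also have "(\<Sum>j\<in>A. (x j)\<^sup>2) = (\<Sum>S\<in>Pow A. 1 / 2 ^ card A * (signed_sum A S x)\<^sup>2)"
    using sum_signed_sum_power2[OF assms(1), of 0 x] by (simp flip: sum_divide_distrib)
  also have "\<dots> powr (p / 2) \<le> (\<Sum>S\<in>Pow A. 1 / 2 ^ card A * ((signed_sum A S x)\<^sup>2) powr (p / 2))"
    by (rule powr_Jensen) (use assms in \<open>auto simp: card_Pow\<close>)
  also have "\<dots> = (\<Sum>S\<in>Pow A. \<bar>signed_sum A S x\<bar> powr p / 2 ^ card A)"
  proof (intro sum.cong refl)
    fix S
    have "((signed_sum A S x)\<^sup>2) powr (p / 2) = (\<bar>signed_sum A S x\<bar> powr 2) powr (p / 2)"
      by (simp add: powr_numeral)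
    then show "1 / 2 ^ card A * ((signed_sum A S x)\<^sup>2) powr (p / 2) = \<bar>signed_sum A S x\<bar> powr p / 2 ^ card A"
      by (simp add: powr_powr del: powr_numeral)
  qed
  finally show ?thesis .
qed

definition Khintchine_const :: "real \<Rightarrow> real"
  where "Khintchine_const p = (2 * p powr p * exp 1) powr (1 / p)"

lemma Khintchine_const_pos: "p > 0 \<Longrightarrow> Khintchine_const p > 0"
  by (simp add: Khintchine_const_def)

text \<open>
  Send \<open>x\<close> to the vector of all its \<open>2 ^ k\<close> signed sums; the normalization turns the \<open>p\<close>-norm
  into a mean over the signs.
\<close>
lemma lattice_into_lp:
  assumes p: "p > 2"
  obtains J where "\<And>x. J x \<in> lp_space p"
    and "\<And>x y. edist k x y \<le> lp_dist p (J x) (J y)"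
    and "\<And>x y. lp_dist p (J x) (J y) \<le> Khintchine_const p * edist k x y"
proof -
  let ?A = "{..<k}"
  obtain h where h: "bij_betw h {..<2 ^ k :: nat} (Pow ?A)"
    using ex_bij_betw_nat_finite[of "Pow ?A"] by (auto simp: card_Pow atLeast0LessThan)
  define J where "J x i = (if i < 2 ^ k then
      signed_sum ?A (h i) (\<lambda>j. real_of_int (x j)) / (2 ^ k) powr (1 / p) else 0)" for x :: "nat \<Rightarrow> int" and i
  have J0: "J x \<in> lp_space p" for x
    unfolding lp_space_def
    by (rule CollectI, rule summable_finite[of "{..<2 ^ k}"]) (auto simp: J_def)
  have dist: "lp_dist p (J x) (J y) powr p
      = (\<Sum>S\<in>Pow ?A. \<bar>signed_sum ?A S (\<lambda>j. real_of_int (x j - y j))\<bar> powr p / 2 ^ card ?A)" for x y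
  proof -
    let ?d = "\<lambda>j. real_of_int (x j - y j)"
    have "(\<Sum>i. \<bar>J x i - J y i\<bar> powr p) = (\<Sum>i<2 ^ k. \<bar>J x i - J y i\<bar> powr p)"
      by (rule suminf_finite) (auto simp: J_def)
    also have "\<dots> = (\<Sum>i<2 ^ k. \<bar>signed_sum ?A (h i) ?d\<bar> powr p / 2 ^ k)"
    proof (intro sum.cong refl)
      fix i :: nat assume "i \<in> {..<2 ^ k}"
      then have "J x i - J y i = signed_sum ?A (h i) ?d / (2 ^ k) powr (1 / p)"
        by (simp add: J_def signed_sum_diff flip: diff_divide_distrib)
      then show "\<bar>J x i - J y i\<bar> powr p = \<bar>signed_sum ?A (h i) ?d\<bar> powr p / 2 ^ k"
        using p by (simp add: abs_divide powr_divide powr_powr)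
    qed
    also have "\<dots> = (\<Sum>S\<in>Pow ?A. \<bar>signed_sum ?A S ?d\<bar> powr p / 2 ^ k)"
      by (rule sum.reindex_bij_betw[OF h])
    finally have eq: "(\<Sum>i. \<bar>J x i - J y i\<bar> powr p) = (\<Sum>S\<in>Pow ?A. \<bar>signed_sum ?A S ?d\<bar> powr p / 2 ^ k)" .
    show ?thesis
      using p by (simp add: lp_dist_def lp_norm_def eq powr_powr sum_nonneg)
  qed
  have nn: "lp_dist p u v \<ge> 0" for u v by (simp add: lp_dist_def lp_norm_def)
  have root: "a \<le> b" if "a powr p \<le> b powr p" "b \<ge> 0" for a b :: real
    using that p powr_less_mono2[of p b a] by linarith
  show thesis
  proof
    show "J x \<in> lp_space p" for x by (rule J0)
    show "edist k x y \<le> lp_dist p (J x) (J y)" for x y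
      by (rule root) (use Khintchine_lower[of ?A p "\<lambda>j. real_of_int (x j - y j)"] p nn in \<open>auto simp: dist edist_def\<close>)
    show "lp_dist p (J x) (J y) \<le> Khintchine_const p * edist k x y" for x y
    proof (rule root)
      have "(Khintchine_const p * edist k x y) powr p = 2 * p powr p * exp 1 * edist k x y powr p"
        using p by (simp add: Khintchine_const_def powr_mult powr_powr)
      then show "lp_dist p (J x) (J y) powr p \<le> (Khintchine_const p * edist k x y) powr p"
        using Khintchine_upper[of ?A p "\<lambda>j. real_of_int (x j - y j)"] p by (simp add: dist edist_def)
      show "Khintchine_const p * edist k x y \<ge> 0"
        using Khintchine_const_pos[of p] p by simp
    qed
  qed
qed

text \<open>
  The number of integers of absolute value at most \<open>576 * k ^ 7\<close>, the walk length that the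
  concentration estimate requires.
\<close>
definition grid_side :: "nat \<Rightarrow> nat"
  where "grid_side k = 2 * (576 * k ^ 7) + 1"

text \<open>
  The side of the box is polynomial in \<open>k\<close>, so \<open>ln n\<close> is of order \<open>k * ln k\<close>, while
  \<open>ln (ln n)\<close> is at least \<open>ln k\<close>. Starting with \<open>k = 3\<close> ensures \<open>ln k \<ge> 1\<close>.
\<close>
lemma ln_grid_side_power_le:
  assumes k: "k \<ge> 3" and n: "n = grid_side k ^ k"
  shows "0 \<le> ln (real n) / (ln (ln (real n)))\<^sup>2" "ln (real n) / (ln (ln (real n)))\<^sup>2 \<le> 18 * real k"
proof -
  define a where "a = ln (real k)"
  have e3: "exp 1 \<le> (3 :: real)" by (rule exp_le)
  have a1: "a \<ge> 1"
    unfolding a_def using k e3 by (subst ln_ge_iff) auto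
  have side0: "real (grid_side k) > 0" by (simp only: of_nat_0_less_iff) (simp add: grid_side_def)
  have ln_n: "ln (real n) = real k * ln (real (grid_side k))"
    using side0 by (simp add: n ln_realpow)
  have "exp 1 \<le> real (grid_side k)"
  proof -
    have "1 \<le> k ^ 7" using k by (intro one_le_power) auto
    then have "3 \<le> grid_side k" by (simp add: grid_side_def)
    then show ?thesis using e3 by linarith
  qed
  then have "1 \<le> ln (real (grid_side k))" using side0 by (simp add: ln_ge_iff)
  then have lower: "real k \<le> ln (real n)"
    unfolding ln_n using mult_left_mono[of 1 _ "real k"] by simp
  have "ln (real (grid_side k)) \<le> ln (exp 1 ^ 11 * real k ^ 7)"
  proof (subst ln_le_cancel_iff)
    have "2 \<le> exp (1::real)" using exp_ge_add_one_self[of "1::real"] by simp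
    then have "2 ^ 11 \<le> exp (1::real) ^ 11" by (rule power_mono) simp
    then have "1153 \<le> exp (1::real) ^ 11" by simp
    then have "1153 * real k ^ 7 \<le> exp 1 ^ 11 * real k ^ 7" by (rule mult_right_mono) simp
    moreover have "1 \<le> real k ^ 7" using k by (intro one_le_power) auto
    ultimately show "real (grid_side k) \<le> exp 1 ^ 11 * real k ^ 7"
      by (simp add: grid_side_def)
  qed (use side0 k in auto)
  also have "\<dots> = 11 + 7 * a"
    using k by (simp add: a_def ln_mult ln_realpow)
  also have "\<dots> \<le> 18 * a" using a1 by simp
  finally have upper: "ln (real n) \<le> 18 * real k * a"
    unfolding ln_n using k by (simp add: mult_left_mono)
  have "a \<le> ln (ln (real n))"
    unfolding a_def using lower k by simp
  then have "a * 1 \<le> ln (ln (real n)) * ln (ln (real n))"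
    using a1 by (intro mult_mono) auto
  then have b: "a \<le> (ln (ln (real n)))\<^sup>2" by (simp add: power2_eq_square)
  show "0 \<le> ln (real n) / (ln (ln (real n)))\<^sup>2" using lower by simp
  have "ln (real n) \<le> 18 * real k * (ln (ln (real n)))\<^sup>2"
    using upper b mult_left_mono[OF b, of "18 * real k"] by linarith
  then show "ln (real n) / (ln (ln (real n)))\<^sup>2 \<le> 18 * real k"
    using a1 b by (simp add: divide_le_eq)
qed

lemma infinite_grid_sizes: "infinite ((\<lambda>k. grid_side k ^ k) ` {3..})"
  unfolding infinite_nat_iff_unbounded
proof
  fix m :: nat
  have "m + 3 < 2 ^ (m + 3)" by (rule less_exp)
  also have "\<dots> \<le> grid_side (m + 3) ^ (m + 3)"
    by (intro power_mono) (auto simp: grid_side_def)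
  finally show "\<exists>n>m. n \<in> (\<lambda>k. grid_side k ^ k) ` {3..}"
    by (intro exI[of _ "grid_side (m + 3) ^ (m + 3)"]) auto
qed

lemma embedded_box_dimension_bound:
  assumes p: "p > 2" and k: "k > 0" and T: "T \<ge> 576 * k ^ 7" and D: "D \<ge> 1" and K: "K > 0"
    and J: "\<And>x y. edist k x y \<le> lp_dist p (J x) (J y)"
      "\<And>x y. lp_dist p (J x) (J y) \<le> K * edist k x y"
    and emb: "embeds_with_distortion D (J ` lattice_box k T) (lp_dist p) (lp_fin_space m) (lp_fin_dist p m)"
  shows "(1 / (D * K)) powr p / (2 powr p * (2 * walk_moment_const p)) * real k powr (p / 2) \<le> real m"
proof -
  obtain f s where s: "s > 0" and f: "\<And>u v. u \<in> J ` lattice_box k T \<Longrightarrow> v \<in> J ` lattice_box k T \<Longrightarrow>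
      s * lp_dist p u v \<le> lp_fin_dist p m (f u) (f v) \<and> lp_fin_dist p m (f u) (f v) \<le> D * s * lp_dist p u v"
    using emb unfolding embeds_with_distortion_def by blast
  have "(s / (D * s * K)) powr p / (2 powr p * (2 * walk_moment_const p)) * real k powr (p / 2) \<le> real m"
  proof (rule lattice_box_dimension_bound[OF p k T s])
    show "D * s * K > 0" using D s K by simp
    fix x y assume "x \<in> lattice_box k T" "y \<in> lattice_box k T"
    then have *: "s * lp_dist p (J x) (J y) \<le> lp_fin_dist p m (f (J x)) (f (J y))"
      "lp_fin_dist p m (f (J x)) (f (J y)) \<le> D * s * lp_dist p (J x) (J y)"
      using f by auto
    have "s * edist k x y \<le> s * lp_dist p (J x) (J y)"
      using J(1) s by (intro mult_left_mono) auto
    then show "s * edist k x y \<le> lp_fin_dist p m ((f \<circ> J) x) ((f \<circ> J) y)"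
      using * by simp
    have "D * s * lp_dist p (J x) (J y) \<le> D * s * (K * edist k x y)"
      using J(2) s D by (intro mult_left_mono) auto
    then show "lp_fin_dist p m ((f \<circ> J) x) ((f \<circ> J) y) \<le> D * s * K * edist k x y"
      using * by (simp add: mult.assoc)
  qed
  moreover have "s / (D * s * K) = 1 / (D * K)" using s by simp
  ultimately show ?thesis by simp
qed

lemma inj_on_lattice_box:
  assumes "\<And>x y. edist k x y \<le> lp_dist p (J x) (J y)"
  shows "inj_on J (lattice_box k T)"
proof (rule inj_onI)
  fix x y assume xy: "x \<in> lattice_box k T" "y \<in> lattice_box k T" "J x = J y"
  have "lp_dist p (J y) (J y) = 0" by (simp add: lp_dist_def lp_norm_def)
  then have "edist k x y = 0" using assms[of x y] xy(3) edist_nonneg[of k x y] by simp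
  then have "\<forall>j<k. x j = y j" by (simp add: edist_def L2_set_eq_0_iff)
  then show "x = y"
    using xy(1,2) unfolding lattice_box_def by (intro PiE_ext) auto
qed

theorem mainTheorem2:
  fixes p :: real
  assumes "2 < p"
  shows "\<exists>(I :: nat set) (M :: nat \<Rightarrow> (nat \<Rightarrow> real) set).
    infinite I \<and> I \<subseteq> {3..} \<and>
    (\<forall>n\<in>I. M n \<subseteq> lp_space p \<and> finite (M n) \<and> card (M n) = n) \<and>
    (\<forall>D\<ge>1. \<exists>c>0. \<forall>n\<in>I. \<forall>m :: nat.
      embeds_with_distortion D (M n) (lp_dist p) (lp_fin_space m) (lp_fin_dist p m) \<longrightarrow>
      real m \<ge> c * (ln (real n) / (ln (ln (real n)))\<^sup>2) powr (p / 2))"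
proof -
  define K where "K = Khintchine_const p"
  have K: "K > 0" using Khintchine_const_pos assms by (simp add: K_def)
  have "\<exists>J. (\<forall>x. J x \<in> lp_space p) \<and> (\<forall>x y. edist k x y \<le> lp_dist p (J x) (J y))
      \<and> (\<forall>x y. lp_dist p (J x) (J y) \<le> K * edist k x y)" for k
    using lattice_into_lp[OF assms, of k] unfolding K_def by metis
  then obtain J where J: "\<And>k x. J k x \<in> lp_space p"
    "\<And>k x y. edist k x y \<le> lp_dist p (J k x) (J k y)"
    "\<And>k x y. lp_dist p (J k x) (J k y) \<le> K * edist k x y"
    by metis
  define N where "N k = grid_side k ^ k" for k
  define I where "I = N ` {3..}"
  define M where "M n = (let k = inv_into {3..} N n in J k ` lattice_box k (576 * k ^ 7))" for n
  have I: "\<exists>k\<ge>3. n = N k \<and> M n = J k ` lattice_box k (576 * k ^ 7)" if "n \<in> I" for n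
    using that inv_into_into[of n N "{3..}"] f_inv_into_f[of n N "{3..}"]
    by (intro exI[of _ "inv_into {3..} N n"]) (auto simp: I_def M_def Let_def)
  show ?thesis
  proof (intro exI[of _ I] exI[of _ M] conjI ballI allI impI)
    show "infinite I" unfolding I_def N_def by (rule infinite_grid_sizes)
    show "I \<subseteq> {3..}"
    proof
      fix n assume "n \<in> I"
      then obtain k where k: "k \<ge> 3" "n = N k" using I by blast
      have "3 ^ 1 \<le> (3::nat) ^ k" using k(1) by (intro power_increasing) auto
      also have "\<dots> \<le> N k" unfolding N_def
        using k(1) by (intro power_mono) (auto simp: grid_side_def)
      finally show "n \<in> {3..}" using k by simp
    qed
  next
    fix n assume "n \<in> I"
    then obtain k where k: "n = N k" "M n = J k ` lattice_box k (576 * k ^ 7)" using I by blast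
    show "M n \<subseteq> lp_space p" using J(1) k(2) by auto
    show "finite (M n)" using k(2) by simp
    show "card (M n) = n"
      unfolding k(2) card_image[OF inj_on_lattice_box[OF J(2)]]
      by (simp add: card_lattice_box k(1) N_def grid_side_def)
  next
    fix D :: real assume D: "D \<ge> 1"
    define c where "c = (1 / (D * K)) powr p / (2 powr p * (2 * walk_moment_const p))"
    have c: "c > 0"
      using D K walk_moment_const_pos[of p] assms by (simp add: c_def)
    show "\<exists>c>0. \<forall>n\<in>I. \<forall>m :: nat.
      embeds_with_distortion D (M n) (lp_dist p) (lp_fin_space m) (lp_fin_dist p m) \<longrightarrow>
      real m \<ge> c * (ln (real n) / (ln (ln (real n)))\<^sup>2) powr (p / 2)"
    proof (intro exI[of _ "c / 18 powr (p / 2)"] conjI ballI allI impI)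
      show "c / 18 powr (p / 2) > 0" using c by simp
      fix n m
      assume "n \<in> I" and emb: "embeds_with_distortion D (M n) (lp_dist p) (lp_fin_space m) (lp_fin_dist p m)"
      then obtain k where k: "k \<ge> 3" "n = N k" "M n = J k ` lattice_box k (576 * k ^ 7)" using I by blast
      define X where "X = ln (real n) / (ln (ln (real n)))\<^sup>2"
      have X: "0 \<le> X" "X \<le> 18 * real k"
        unfolding X_def using ln_grid_side_power_le[OF k(1)] k(2) by (auto simp: N_def)
      have "X powr (p / 2) \<le> (18 * real k) powr (p / 2)"
        using X assms by (intro powr_mono2) auto
      also have "\<dots> = 18 powr (p / 2) * real k powr (p / 2)"
        by (simp add: powr_mult)
      finally have "c / 18 powr (p / 2) * X powr (p / 2)
          \<le> c / 18 powr (p / 2) * (18 powr (p / 2) * real k powr (p / 2))"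
        using c by (intro mult_left_mono) auto
      also have "\<dots> = c * real k powr (p / 2)" by simp
      also have "\<dots> \<le> real m"
        unfolding c_def
        by (rule embedded_box_dimension_bound[OF assms _ _ D K J(2,3)])
          (use k emb in auto)
      finally show "real m \<ge> c / 18 powr (p / 2) * (ln (real n) / (ln (ln (real n)))\<^sup>2) powr (p / 2)"
        by (simp add: X_def)
    qed
  qed
qed

end
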